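(* Let $X,Y$ be real nonzero Banach spaces, $T:Y\rightrightarrows Y^*$ a maximal monotone operator of Gossez type (D) with strong representative function $h_T$, and $A:X\to Y$ linear continuous with $\operatorname{pr}_Y(\operatorname{dom}h_T)\cap\operatorname{im}A\neq\emptyset$. Then (a) ${}^{ic}(D(T)-\operatorname{im}A)=\operatorname{ri}(D(T)-\operatorname{im}A)={}^{ic}(\operatorname{co}D(T)-\operatorname{im}A)=\operatorname{ri}(\operatorname{co}D(T)-\operatorname{im}A)={}^{ic}(\operatorname{pr}_Y(\operatorname{dom}h_T)-\operatorname{im}A)=\operatorname{ri}(\operatorname{pr}_Y(\operatorname{dom}h_T)-\operatorname{im}A)$; (b) consequently the conditions $0\in{}^{ic}(D(T)-\operatorname{im}A)$, $0\in\operatorname{ri}(D(T)-\operatorname{im}A)$, $0\in{}^{ic}(\operatorname{co}D(T)-\operatorname{im}A)$, $0\in\operatorname{ri}(\operatorname{co}D(T)-\operatorname{im}A)$, $0\in{}^{ic}(\operatorname{pr}_Y(\operatorname{dom}h_T)-\operatorname{im}A)$, $0\in\operatorname{ri}(\operatorname{pr}_Y(\operatorname{dom}h_T)-\operatorname{im}A)$ are equivalent, and each implies that $A^*TA$ is maximal monotone of Gossez type (D).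
   Context: Spaces identified with their images in their biduals. $D(T)$ is the domain of $T$; $\operatorname{co}$ convex hull; $\operatorname{im}A=A(X)$; $A^*TA(x)=A^*(T(Ax))$. Coupling $c(y,y^* )=\langle y^*,y\rangle$. Conjugate of $h$ on $Y\times Y^*$: $h^*(y^*,y^{**})=\sup_{(y,z^* )}\{\langle y^*,y\rangle+\langle y^{**},z^*\rangle-h(y,z^* )\}$. Representative function of monotone $T$: convex norm-lsc $h_T$ with $h_T\ge c$ and $G(T)\subseteq\{h_T=c\}$; strong if $h_T^*(y^*,y^{**})\ge\langle y^{**},y^*\rangle$ for all. Gossez's closure $\overline T:Y^{**}\rightrightarrows Y^*$ has graph $\{(y^{**},y^* ):\langle y^{**}-z,y^*-z^*\rangle\ge0\ \forall(z,z^* )\in G(T)\}$; maximal monotone $T$ is of Gossez type (D) if each point of $G(\overline T)$ is the $w^*\times\|\cdot\|_*$-limit of a bounded net in $G(T)$. $\operatorname{icr}D=\{u:\forall x\in\operatorname{aff}(D-D)\ \exists\delta>0\ \forall\lambda\in[0,\delta]:u+\lambda x\in D\}$; ${}^{ic}D=\operatorname{icr}D$ if $\operatorname{aff}D$ closed, else $\emptyset$; $\operatorname{ri}D$ = interior relative to $\operatorname{aff}D$ if closed, else $\emptyset$. *)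

theory Defs
  imports "HOL-Analysis.Analysis"
begin

definition graph :: "('y \<Rightarrow> 'b set) \<Rightarrow> ('y \<times> 'b) set" where
  "graph T = {(y, ys). ys \<in> T y}"

definition dom_op :: "('y \<Rightarrow> 'b set) \<Rightarrow> 'y set" where
  "dom_op T = {y. T y \<noteq> {}}"

definition monotone_op :: "('y::real_normed_vector \<Rightarrow> ('y \<Rightarrow>\<^sub>L real) set) \<Rightarrow> bool" where
  "monotone_op T \<longleftrightarrow> (\<forall>(y, ys) \<in> graph T. \<forall>(z, zs) \<in> graph T. 0 \<le> blinfun_apply (ys - zs) (y - z))"

definition maximal_monotone :: "('y::real_normed_vector \<Rightarrow> ('y \<Rightarrow>\<^sub>L real) set) \<Rightarrow> bool" where
  "maximal_monotone T \<longleftrightarrow> monotone_op T \<and>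
     (\<forall>S. monotone_op S \<and> graph T \<subseteq> graph S \<longrightarrow> graph S = graph T)"

definition canon :: "'y::real_normed_vector \<Rightarrow> (('y \<Rightarrow>\<^sub>L real) \<Rightarrow>\<^sub>L real)" where
  "canon y = Blinfun (\<lambda>f. blinfun_apply f y)"

definition gossez_closure :: "('y::real_normed_vector \<Rightarrow> ('y \<Rightarrow>\<^sub>L real) set)
    \<Rightarrow> ((('y \<Rightarrow>\<^sub>L real) \<Rightarrow>\<^sub>L real) \<times> ('y \<Rightarrow>\<^sub>L real)) set" where
  "gossez_closure T = {(yss, ys). \<forall>(z, zs) \<in> graph T.
      0 \<le> blinfun_apply (yss - canon z) (ys - zs)}"

text \<open>Gossez type (D): maximal monotone, and every point of the Gossez closure is the
  (weak-star \<times> norm)-limit of a bounded net in G(T). Nets are represented by proper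
  filters on Y \<times> Y* (the net being the identity along the filter).\<close>
definition gossez_type_D :: "('y::real_normed_vector \<Rightarrow> ('y \<Rightarrow>\<^sub>L real) set) \<Rightarrow> bool" where
  "gossez_type_D T \<longleftrightarrow> maximal_monotone T \<and>
     (\<forall>(yss, ys) \<in> gossez_closure T. \<exists>F :: ('y \<times> ('y \<Rightarrow>\<^sub>L real)) filter.
        F \<noteq> bot \<and> eventually (\<lambda>p. p \<in> graph T) F \<and>
        (\<exists>B. \<forall>\<^sub>F p in F. norm (fst p) \<le> B \<and> norm (snd p) \<le> B) \<and>
        (\<forall>f. ((\<lambda>p. blinfun_apply f (fst p)) \<longlongrightarrow> blinfun_apply yss f) F) \<and>
        ((\<lambda>p. snd p) \<longlongrightarrow> ys) F)"

definition coupling :: "'y::real_normed_vector \<times> ('y \<Rightarrow>\<^sub>L real) \<Rightarrow> real" where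
  "coupling p = blinfun_apply (snd p) (fst p)"

definition convex_ereal_fun :: "('a::real_vector \<Rightarrow> ereal) \<Rightarrow> bool" where
  "convex_ereal_fun h \<longleftrightarrow> (\<forall>x y t. 0 \<le> t \<and> t \<le> 1 \<longrightarrow>
      h (t *\<^sub>R x + (1 - t) *\<^sub>R y) \<le> ereal t * h x + ereal (1 - t) * h y)"

definition lsc_ereal_fun :: "('a::topological_space \<Rightarrow> ereal) \<Rightarrow> bool" where
  "lsc_ereal_fun h \<longleftrightarrow> (\<forall>r::real. closed {x. h x \<le> ereal r})"

definition representative_function ::
  "('y::real_normed_vector \<Rightarrow> ('y \<Rightarrow>\<^sub>L real) set) \<Rightarrow> ('y \<times> ('y \<Rightarrow>\<^sub>L real) \<Rightarrow> ereal) \<Rightarrow> bool" where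
  "representative_function T h \<longleftrightarrow> convex_ereal_fun h \<and> lsc_ereal_fun h \<and>
     (\<forall>p. ereal (coupling p) \<le> h p) \<and> graph T \<subseteq> {p. h p = ereal (coupling p)}"

definition conjugate :: "('y::real_normed_vector \<times> ('y \<Rightarrow>\<^sub>L real) \<Rightarrow> ereal)
    \<Rightarrow> ('y \<Rightarrow>\<^sub>L real) \<times> (('y \<Rightarrow>\<^sub>L real) \<Rightarrow>\<^sub>L real) \<Rightarrow> ereal" where
  "conjugate h q = (SUP p. ereal (blinfun_apply (fst q) (fst p) + blinfun_apply (snd q) (snd p)) - h p)"

definition strong_representative_function ::
  "('y::real_normed_vector \<Rightarrow> ('y \<Rightarrow>\<^sub>L real) set) \<Rightarrow> ('y \<times> ('y \<Rightarrow>\<^sub>L real) \<Rightarrow> ereal) \<Rightarrow> bool" where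
  "strong_representative_function T h \<longleftrightarrow> representative_function T h \<and>
     (\<forall>ys yss. ereal (blinfun_apply yss ys) \<le> conjugate h (ys, yss))"

definition effdom :: "('a \<Rightarrow> ereal) \<Rightarrow> 'a set" where
  "effdom h = {p. h p < \<infinity>}"

definition adj_comp :: "('x::real_normed_vector \<Rightarrow>\<^sub>L 'y::real_normed_vector)
    \<Rightarrow> ('y \<Rightarrow> ('y \<Rightarrow>\<^sub>L real) set) \<Rightarrow> 'x \<Rightarrow> ('x \<Rightarrow>\<^sub>L real) set" where
  "adj_comp A T x = (\<lambda>ys. ys o\<^sub>L A) ` T (blinfun_apply A x)"

definition setdiff :: "'a::ab_group_add set \<Rightarrow> 'a set \<Rightarrow> 'a set" where
  "setdiff S U = {s - u | s u. s \<in> S \<and> u \<in> U}"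

definition icr :: "'a::real_vector set \<Rightarrow> 'a set" where
  "icr D = {u. \<forall>x \<in> affine hull (setdiff D D). \<exists>\<delta>>0. \<forall>t\<in>{0..\<delta>}. u + t *\<^sub>R x \<in> D}"

definition ic :: "'a::real_normed_vector set \<Rightarrow> 'a set" where
  "ic D = (if closed (affine hull D) then icr D else {})"

definition ri :: "'a::real_normed_vector set \<Rightarrow> 'a set" where
  "ri D = (if closed (affine hull D) then rel_interior D else {})"

end

theory Submission
  imports Defs
begin

text \<open>
  A strong representative function \<open>h\<close> yields, for every point \<open>u\<close> of the intrinsic core of
  \<open>fst ` effdom h - range A\<close>, a convex set \<open>E\<close> (an epigraph for the composition of \<open>h\<close> with \<open>A\<close>,
  shifted by \<open>u\<close>) that lies above the coupling.  A Baire category argument and a sandwich theorem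
  show that the conjugate of the composition is exact, so it lies above the coupling of the dual
  with the bidual, and the points where it touches the coupling form the graph of \<open>A\<^sup>* T (A x + u)\<close>.

  For any such \<open>E\<close>, Fenchel duality makes \<open>r - coupling q + coupling (q - z) + \<parallel>q - z\<parallel>\<^sup>2 / 2\<close>
  arbitrarily small on \<open>E\<close>, and iterating this gives a Broendsted-Rockafellar theorem, hence
  maximality and negative infimum over the bidual of the touching set \<open>M\<close>.  Applied once more to
  the convex hull of the graph of the coupling over \<open>M\<close>, duality with a penalty and Goldstine's theorem
  place points of \<open>M\<close> in a bounded set near each point of the Gossez closure, which is type (D).

  In particular the graph is nonempty, so every \<open>u\<close> as above lies in \<open>dom_op T - range A\<close>;
  this traps all six relative interiors between each other.
\<close>

section \<open>Hahn-Banach and convex separation\<close>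

text \<open>In a nonreflexive space norms need not be attained, so duality holds only up to an
  error; the approximate statements therefore carry a slack, and exact points come from
  completeness. Hence the touching set is defined through the conjugate of \<open>E\<close>, not
  through \<open>E\<close> itself: limits of points of \<open>E\<close> with vanishing gap satisfy
  that condition without belonging to \<open>E\<close>. The hull of the coupling over the touching
  set is used because membership of a point in the Gossez closure says literally that the conjugate
  of the hull is at most the pairing there. The shift by \<open>u\<close> serves both halves of the
  theorem: type (D) needs \<open>u = 0\<close>, the comparison of relative interiors needs every
  \<open>u\<close>.\<close>

definition sublinear :: "('v::real_vector \<Rightarrow> real) \<Rightarrow> bool" where
  "sublinear q \<longleftrightarrow> (\<forall>x y. q (x + y) \<le> q x + q y) \<and> (\<forall>t\<ge>0. \<forall>x. q (t *\<^sub>R x) = t * q x)"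

lemma sublinear_add: "sublinear q \<Longrightarrow> q (x + y) \<le> q x + q y"
  and sublinear_scale: "sublinear q \<Longrightarrow> 0 \<le> t \<Longrightarrow> q (t *\<^sub>R x) = t * q x"
  by (auto simp: sublinear_def)

lemma sublinear_zero: "sublinear q \<Longrightarrow> q 0 = 0"
  using sublinear_scale[of q 0 0] by simp

lemma sublinear_minus: "sublinear q \<Longrightarrow> - q (- x) \<le> q x"
  using sublinear_add[of q x "- x"] sublinear_zero[of q] by simp

lemma sublinear_odd_imp_linear:
  assumes q: "sublinear q" and odd: "\<And>x. q (- x) = - q x"
  shows "linear q"
proof (rule linearI)
  fix x y
  have "q (x + y) = - q (- x + - y)"
    using odd[of "x + y"] by simp
  moreover have "q (- x + - y) \<le> - q x - q y"
    using sublinear_add[OF q, of "- x" "- y"] odd by simp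
  ultimately show "q (x + y) = q x + q y"
    using sublinear_add[OF q, of x y] by linarith
next
  fix r x
  show "q (r *\<^sub>R x) = r *\<^sub>R q x"
  proof (cases "0 \<le> r")
    case False
    then have "q ((- r) *\<^sub>R (- x)) = (- r) * q (- x)"
      by (intro sublinear_scale[OF q]) simp
    then show ?thesis using odd by simp
  qed (simp add: sublinear_scale[OF q])
qed

text \<open>Of two members of a chain the smaller one serves at both \<open>x\<close> and
  \<open>y\<close>, so subadditivity survives the infimum. Homogeneity needs only one inequality for
  every positive factor; the other follows with the reciprocal factor.\<close>

lemma sublinear_chain_INF:
  assumes "C \<noteq> {}" and sl: "\<And>q. q \<in> C \<Longrightarrow> sublinear q"
    and chain: "\<And>q q'. q \<in> C \<Longrightarrow> q' \<in> C \<Longrightarrow> q \<le> q' \<or> q' \<le> q"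
    and bd: "\<And>x. bdd_below ((\<lambda>q. q x) ` C)"
  shows "sublinear (\<lambda>x. INF q\<in>C. q x)"
  unfolding sublinear_def
proof (intro conjI allI impI)
  fix x y
  have "(INF q\<in>C. q (x + y)) - q' y \<le> (INF q\<in>C. q x)" if q': "q' \<in> C" for q'
  proof (rule cINF_greatest[OF \<open>C \<noteq> {}\<close>])
    fix q assume "q \<in> C"
    with chain[OF this q'] q' obtain q'' where "q'' \<in> C" "q'' \<le> q" "q'' \<le> q'"
      by (metis order_refl)
    then show "(INF q\<in>C. q (x + y)) - q' y \<le> q x"
      using cINF_lower[OF bd, of q'' "x + y"] sublinear_add[OF sl, of q'' x y]
        le_funD[of q'' q x] le_funD[of q'' q' y] by linarith
  qed
  then have "(INF q\<in>C. q (x + y)) - (INF q\<in>C. q x) \<le> (INF q\<in>C. q y)"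
    by (intro cINF_greatest[OF \<open>C \<noteq> {}\<close>]) (simp add: algebra_simps)
  then show "(INF q\<in>C. q (x + y)) \<le> (INF q\<in>C. q x) + (INF q\<in>C. q y)"
    by linarith
next
  fix t :: real and x assume "0 \<le> t"
  show "(INF q\<in>C. q (t *\<^sub>R x)) = t * (INF q\<in>C. q x)"
  proof (cases "t = 0")
    case True
    have "(INF q\<in>C. q (t *\<^sub>R x)) = (INF q\<in>C. 0)"
      using True by (intro INF_cong) (auto simp: sublinear_zero sl)
    then show ?thesis
      using True \<open>C \<noteq> {}\<close> by simp
  next
    case False
    with \<open>0 \<le> t\<close> have "t > 0" by simp
    have *: "s * (INF q\<in>C. q z) \<le> (INF q\<in>C. q (s *\<^sub>R z))" if "s > 0" for s z
      using that by (intro cINF_greatest[OF \<open>C \<noteq> {}\<close>])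
        (auto simp: sublinear_scale sl intro!: cINF_lower[OF bd])
    have "(1 / t) * (INF q\<in>C. q (t *\<^sub>R x)) \<le> (INF q\<in>C. q x)"
      using *[of "1 / t" "t *\<^sub>R x"] \<open>t > 0\<close> by simp
    then have "(INF q\<in>C. q (t *\<^sub>R x)) \<le> t * (INF q\<in>C. q x)"
      using \<open>t > 0\<close> by (simp add: field_simps)
    then show ?thesis
      using *[OF \<open>t > 0\<close>, of x] by linarith
  qed
qed

text \<open>Lowers \<open>q\<close> in the direction \<open>- a\<close>. For a minimal
  \<open>q\<close> this changes nothing, so \<open>q (- a) \<le> - q a\<close>, and with
  \<open>sublinear_minus\<close> the functional is odd.\<close>

lemma sublinear_shift_INF:
  fixes q :: "'v::real_vector \<Rightarrow> real" and a :: 'v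
  assumes q: "sublinear q"
  defines "g \<equiv> \<lambda>x. INF t\<in>{0..}. q (x + t *\<^sub>R a) - t * q a"
  shows "sublinear g" and "g \<le> q" and "g (- a) \<le> - q a"
proof -
  have g: "g x = (INF t\<in>{0..}. q (x + t *\<^sub>R a) - t * q a)" for x
    by (simp add: g_def)
  have lb: "- q (- x) \<le> q (x + t *\<^sub>R a) - t * q a" if "0 \<le> t" for x t
    using sublinear_add[OF q, of "x + t *\<^sub>R a" "- x"] sublinear_scale[OF q that, of a] by simp
  have bd: "bdd_below ((\<lambda>t. q (x + t *\<^sub>R a) - t * q a) ` {0..})" for x
    using lb[of _ x] by (intro bdd_belowI[of _ "- q (- x)"]) auto
  have le: "g x \<le> q (x + t *\<^sub>R a) - t * q a" if "0 \<le> t" for x t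
    unfolding g using that by (intro cINF_lower[OF bd]) simp
  show "g \<le> q"
    using le[of 0] by (auto simp: le_fun_def)
  show "g (- a) \<le> - q a"
    using le[of 1 "- a"] sublinear_zero[OF q] by simp
  show "sublinear g"
    unfolding sublinear_def
  proof (intro conjI allI impI)
    fix x y
    have "g (x + y) - (q (y + t *\<^sub>R a) - t * q a) \<le> g x" if "0 \<le> t" for t
      unfolding g[of x]
    proof (rule cINF_greatest)
      fix s :: real assume s: "s \<in> {0..}"
      have "g (x + y) \<le> q (x + s *\<^sub>R a + (y + t *\<^sub>R a)) - (s + t) * q a"
        using le[of "s + t" "x + y"] s that by (simp add: algebra_simps)
      then show "g (x + y) - (q (y + t *\<^sub>R a) - t * q a) \<le> q (x + s *\<^sub>R a) - s * q a"
        using sublinear_add[OF q, of "x + s *\<^sub>R a" "y + t *\<^sub>R a"] by (simp add: algebra_simps)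
    qed simp
    then have "g (x + y) - g x \<le> g y"
      unfolding g[of y] by (intro cINF_greatest) (auto simp: algebra_simps)
    then show "g (x + y) \<le> g x + g y" by linarith
  next
    fix r :: real and x assume "0 \<le> r"
    have half: "r * g x \<le> g (r *\<^sub>R x)" if "r > 0" for r x
      unfolding g[of "r *\<^sub>R x"]
    proof (rule cINF_greatest)
      fix s :: real assume s: "s \<in> {0..}"
      have "r * g x \<le> r * (q (x + (s / r) *\<^sub>R a) - (s / r) * q a)"
        using le[of "s / r" x] that s by (intro mult_left_mono) auto
      also have "\<dots> = q (r *\<^sub>R (x + (s / r) *\<^sub>R a)) - s * q a"
        using that by (simp add: sublinear_scale[OF q less_imp_le] right_diff_distrib)
      also have "\<dots> = q (r *\<^sub>R x + s *\<^sub>R a) - s * q a"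
        using that by (simp add: scaleR_add_right)
      finally show "r * g x \<le> q (r *\<^sub>R x + s *\<^sub>R a) - s * q a" .
    qed simp
    show "g (r *\<^sub>R x) = r * g x"
    proof (cases "r = 0")
      case True
      have "g 0 \<le> 0" "0 \<le> g 0"
        using le[of 0 0] sublinear_zero[OF q]
        by (auto simp: g sublinear_scale[OF q] intro!: cINF_greatest)
      then show ?thesis using True by simp
    next
      case False
      with \<open>0 \<le> r\<close> have "r > 0" by simp
      then show ?thesis
        using half[of r x] half[of "1 / r" "r *\<^sub>R x"] by (simp add: field_simps)
    qed
  qed
qed

text \<open>A minimal sublinear functional is linear.\<close>

theorem hahn_banach_sublinear:
  assumes p: "sublinear p"
  obtains m where "linear m" "m \<le> p"
proof -
  define SL where "SL = {q. sublinear q \<and> q \<le> p}"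
  have "\<exists>m\<in>SL. \<forall>a\<in>SL. a \<le> m \<longrightarrow> a = m"
  proof (rule predicate_Zorn)
    show "partial_order_on SL (relation_of (\<lambda>f g. g \<le> f) SL)"
      by (rule partial_order_on_relation_ofI) auto
  next
    fix C assume C: "C \<in> Chains (relation_of (\<lambda>f g. g \<le> f) SL)"
    then have CS: "C \<subseteq> SL" and chain: "\<And>q q'. q \<in> C \<Longrightarrow> q' \<in> C \<Longrightarrow> q \<le> q' \<or> q' \<le> q"
      by (auto simp: Chains_def relation_of_def)
    show "\<exists>u\<in>SL. \<forall>a\<in>C. u \<le> a"
    proof (cases "C = {}")
      case True
      then show ?thesis using p by (auto simp: SL_def)
    next
      case False
      have bd: "bdd_below ((\<lambda>q. q x) ` C)" for x
      proof (rule bdd_belowI)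
        fix r assume "r \<in> (\<lambda>q. q x) ` C"
        then obtain q where "q \<in> C" "r = q x" by auto
        then show "- p (- x) \<le> r"
          using CS sublinear_minus[of q x] le_funD[of q p "- x"] by (force simp: SL_def)
      qed
      have low: "(\<lambda>x. INF q\<in>C. q x) \<le> q" if "q \<in> C" for q
        using that by (auto simp: le_fun_def intro!: cINF_lower[OF bd])
      moreover have "(\<lambda>x. INF q\<in>C. q x) \<in> SL"
        using sublinear_chain_INF[OF False _ chain bd] CS low False
        by (force simp: SL_def intro: order_trans)
      ultimately show ?thesis by blast
    qed
  qed
  then obtain m where m: "sublinear m" "m \<le> p"
    and min: "\<And>q. sublinear q \<Longrightarrow> q \<le> p \<Longrightarrow> q \<le> m \<Longrightarrow> q = m"
    by (auto simp: SL_def)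
  have "m (- a) \<le> - m a" for a
    using sublinear_shift_INF(3)[OF m(1), of a]
      fun_cong[OF min[OF sublinear_shift_INF(1)[OF m(1)] order_trans[OF sublinear_shift_INF(2)[OF m(1)] m(2)]
        sublinear_shift_INF(2)[OF m(1)], of a], of "- a"] by (simp only:)
  then have "m (- a) = - m a" for a
    using sublinear_minus[OF m(1), of "- a"] by (simp add: antisym)
  then show thesis
    using that m sublinear_odd_imp_linear by blast
qed

lemma convex_on_UNIV_comb:
  assumes "convex_on UNIV f" "0 \<le> u" "0 \<le> v" "u + v = 1"
  shows "f (u *\<^sub>R x + v *\<^sub>R y) \<le> u * f x + v * f y"
  using assms by (simp add: convex_on_def)

text \<open>Linear minorants of \<open>\<psi>\<close> are those of its positively homogeneous hull
  \<open>p\<close>, the infimum of \<open>\<psi> (t x) / t\<close>. Convexity together with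
  \<open>0 \<le> \<psi> 0\<close> keeps this infimum finite (\<open>opp\<close>) and makes it
  sublinear.\<close>

lemma convex_linear_minorant:
  fixes \<psi> :: "'v::real_vector \<Rightarrow> real"
  assumes cvx: "convex_on UNIV \<psi>" and zero: "0 \<le> \<psi> 0"
  obtains m where "linear m" "m \<le> \<psi>"
proof -
  have comb: "\<psi> ((s / (s + t)) *\<^sub>R x + (t / (s + t)) *\<^sub>R y) \<le> (s / (s + t)) * \<psi> x + (t / (s + t)) * \<psi> y"
    if "s > 0" "t > 0" for s t x y
  proof -
    have "s / (s + t) + t / (s + t) = 1"
      using that by (simp flip: add_divide_distrib)
    then show ?thesis
      using that by (intro convex_on_UNIV_comb[OF cvx]) auto
  qed
  have opp: "- (\<psi> ((- s) *\<^sub>R x) / s) \<le> \<psi> (t *\<^sub>R x) / t" if "s > 0" "t > 0" for s t x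
  proof -
    have "(s / (s + t)) *\<^sub>R (t *\<^sub>R x) + (t / (s + t)) *\<^sub>R ((- s) *\<^sub>R x) = 0"
      by (simp add: mult.commute)
    then have "0 \<le> (s / (s + t)) * \<psi> (t *\<^sub>R x) + (t / (s + t)) * \<psi> ((- s) *\<^sub>R x)"
      using comb[OF that, of "t *\<^sub>R x" "(- s) *\<^sub>R x"] zero by (metis order_trans)
    then have "0 \<le> (s * \<psi> (t *\<^sub>R x) + t * \<psi> ((- s) *\<^sub>R x)) / (s + t)"
      by (simp add: add_divide_distrib)
    then show ?thesis
      using that by (simp add: field_simps zero_le_divide_iff)
  qed
  define p where "p x = (INF t\<in>{0<..}. \<psi> (t *\<^sub>R x) / t)" for x
  have bd: "bdd_below ((\<lambda>t. \<psi> (t *\<^sub>R x) / t) ` {0<..})" for x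
    using opp[of 1 _ x] by (intro bdd_belowI[of _ "- \<psi> (- x)"]) auto
  have le: "p x \<le> \<psi> (t *\<^sub>R x) / t" if "t > 0" for x t
    unfolding p_def using that by (intro cINF_lower[OF bd]) simp
  have "sublinear p"
    unfolding sublinear_def
  proof (intro conjI allI impI)
    fix x y
    have "p (x + y) - \<psi> (t *\<^sub>R y) / t \<le> p x" if "0 < t" for t
      unfolding p_def[of x]
    proof (rule cINF_greatest)
      fix s :: real assume "s \<in> {0<..}"
      then have s: "s > 0" by simp
      \<comment> \<open>The scale \<open>s * t / (s + t)\<close> turns \<open>x + y\<close> into a
        convex combination of \<open>s x\<close> and \<open>t y\<close>.\<close>
      have "p (x + y) \<le> \<psi> ((s * t / (s + t)) *\<^sub>R (x + y)) / (s * t / (s + t))"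
        using s that by (intro le) simp
      also have "(s * t / (s + t)) *\<^sub>R (x + y) = (t / (t + s)) *\<^sub>R (s *\<^sub>R x) + (s / (t + s)) *\<^sub>R (t *\<^sub>R y)"
        by (simp add: scaleR_add_right mult.commute add.commute)
      also have "\<psi> \<dots> / (s * t / (s + t)) \<le>
          ((t / (t + s)) * \<psi> (s *\<^sub>R x) + (s / (t + s)) * \<psi> (t *\<^sub>R y)) / (s * t / (s + t))"
        using s that by (intro divide_right_mono comb) auto
      also have "\<dots> = \<psi> (s *\<^sub>R x) / s + \<psi> (t *\<^sub>R y) / t"
      proof -
        have "(t / n * A + s / n * B) / (s * t / n) = A / s + B / t" if "n > 0" for n A B
          using s \<open>0 < t\<close> that by (simp add: field_simps)
        from this[of "s + t"] show ?thesis
          using s that by (simp add: add.commute)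
      qed
      finally show "p (x + y) - \<psi> (t *\<^sub>R y) / t \<le> \<psi> (s *\<^sub>R x) / s" by simp
    qed simp
    then have "p (x + y) - p x \<le> p y"
      unfolding p_def[of y] by (intro cINF_greatest) (auto simp: algebra_simps)
    then show "p (x + y) \<le> p x + p y" by linarith
  next
    fix r :: real and x assume "0 \<le> r"
    have half: "r * p x \<le> p (r *\<^sub>R x)" if "r > 0" for r x
      unfolding p_def[of "r *\<^sub>R x"]
    proof (rule cINF_greatest)
      fix s :: real assume "s \<in> {0<..}"
      then show "r * p x \<le> \<psi> (s *\<^sub>R r *\<^sub>R x) / s"
        using le[of "s * r" x] that by (simp add: field_simps)
    qed simp
    show "p (r *\<^sub>R x) = r * p x"
    proof (cases "r = 0")
      case True
      have "0 \<le> p 0"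
        unfolding p_def using zero by (intro cINF_greatest) auto
      moreover have "p 0 \<le> 0"
      proof (rule field_le_epsilon)
        fix e :: real assume e: "e > 0"
        \<comment> \<open>\<open>\<psi> 0\<close> may be positive; \<open>p 0\<close> still vanishes
          because \<open>\<psi> 0 / t\<close> tends to 0 for large \<open>t\<close>.\<close>
        have "\<psi> 0 / (1 + \<psi> 0 / e) \<le> e"
          using e zero by (simp add: field_simps)
        then show "p 0 \<le> 0 + e"
          using le[of "1 + \<psi> 0 / e" 0] e zero by (simp add: add_pos_nonneg)
      qed
      ultimately show ?thesis using True by simp
    next
      case False
      with \<open>0 \<le> r\<close> have "r > 0" by simp
      then show ?thesis
        using half[of r x] half[of "1 / r" "r *\<^sub>R x"] by (simp add: field_simps)
    qed
  qed
  then obtain m where "linear m" "m \<le> p"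
    by (rule hahn_banach_sublinear)
  moreover have "p \<le> \<psi>"
    using le[of 1] by (auto simp: le_fun_def)
  ultimately show thesis
    using that by (meson order_trans)
qed

lemma linear_bounded_above_imp_bounded_linear:
  fixes m :: "'v::real_normed_vector \<Rightarrow> real"
  assumes "linear m" "0 < d" and bd: "\<And>x. norm x < d \<Longrightarrow> m x \<le> K"
  shows "bounded_linear m"
proof -
  interpret linear m by fact
  have "K \<ge> 0" using bd[of 0] \<open>0 < d\<close> zero by simp
  have *: "m x \<le> (2 * K / d) * norm x" for x
  proof (cases "x = 0")
    case False
    have "m ((d / (2 * norm x)) *\<^sub>R x) \<le> K"
      using False \<open>0 < d\<close> by (intro bd) simp
    then show ?thesis
      using False \<open>0 < d\<close> by (simp add: scaleR field_simps)
  qed (simp add: zero)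
  have "\<bar>m x\<bar> \<le> norm x * (2 * K / d)" for x
    using *[of x] *[of "- x"] by (simp add: neg abs_le_iff mult.commute)
  then show ?thesis
    by (intro bounded_linear.intro[OF \<open>linear m\<close>] bounded_linear_axioms.intro exI[of _ "2 * K / d"]) auto
qed

text \<open>Fenchel duality by the value function: \<open>\<psi> w\<close>, the infimum over
  \<open>E\<close> of \<open>P (q + w) + r\<close>, is convex and nonnegative at 0, and a linear
  minorant \<open>m\<close> of it gives \<open>l = - m\<close>. Continuity of \<open>P\<close> makes
  \<open>m\<close> bounded, so \<open>E\<close> needs neither interior nor closedness.\<close>

theorem convex_sandwich:
  fixes E :: "('v::real_normed_vector \<times> real) set" and P :: "'v \<Rightarrow> real"
  assumes E: "convex E" "E \<noteq> {}"
    and P: "convex_on UNIV P" "continuous_on UNIV P"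
    and nonneg: "\<And>q r. (q, r) \<in> E \<Longrightarrow> 0 \<le> r + P q"
  obtains l :: "'v \<Rightarrow>\<^sub>L real" and \<sigma> :: real
  where "\<And>q r. (q, r) \<in> E \<Longrightarrow> l q - \<sigma> \<le> r" "\<And>q. 0 \<le> l q - \<sigma> + P q"
proof -
  obtain q0 r0 where qr0: "(q0, r0) \<in> E"
    using E(2) by auto
  have conv2: "P (u *\<^sub>R x + v *\<^sub>R y) \<le> u * P x + v * P y" if "0 \<le> u" "0 \<le> v" "u + v = 1" for u v x y
    by (rule convex_on_UNIV_comb[OF P(1) that])
  define \<psi> where "\<psi> w = (INF z\<in>E. P (fst z + w) + snd z)" for w
  \<comment> \<open>The midpoint with the fixed point \<open>(q0, r0)\<close>, perturbed by
    \<open>w\<close> and \<open>- w\<close>, gives a lower bound independent of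
    \<open>(q, r)\<close>; thus \<open>\<psi>\<close> is finite everywhere.\<close>
  have "- (P (q0 - w) + r0) \<le> P (q + w) + r" if "(q, r) \<in> E" for q r w
  proof -
    have "(1/2) *\<^sub>R (q, r) + (1/2) *\<^sub>R (q0, r0) \<in> E"
      by (rule convexD[OF E(1) that qr0]) auto
    then have "0 \<le> r / 2 + r0 / 2 + P ((1/2) *\<^sub>R q + (1/2) *\<^sub>R q0)"
      using nonneg by auto
    moreover have "P ((1/2) *\<^sub>R (q + w) + (1/2) *\<^sub>R (q0 - w)) \<le> (1/2) * P (q + w) + (1/2) * P (q0 - w)"
      by (rule conv2) auto
    moreover have "(1/2) *\<^sub>R (q + w) + (1/2) *\<^sub>R (q0 - w) = (1/2) *\<^sub>R q + (1/2) *\<^sub>R q0"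
      by (simp add: algebra_simps)
    ultimately show ?thesis by simp
  qed
  then have bd: "bdd_below ((\<lambda>z. P (fst z + w) + snd z) ` E)" for w
    by (intro bdd_belowI[of _ "- (P (q0 - w) + r0)"]) auto
  have le: "\<psi> w \<le> P (q + w) + r" if "(q, r) \<in> E" for q r w
    using cINF_lower[OF bd that, of w] by (simp add: \<psi>_def)
  have "convex_on UNIV \<psi>"
    unfolding convex_on_def
  proof (intro conjI ballI allI impI)
    fix x y and u v :: real assume uv: "0 \<le> u" "0 \<le> v" "u + v = 1"
    show "\<psi> (u *\<^sub>R x + v *\<^sub>R y) \<le> u * \<psi> x + v * \<psi> y"
    proof (rule field_le_epsilon)
      fix e :: real assume "e > 0"
      have ex: "\<exists>(q, r)\<in>E. P (q + x) + r < \<psi> x + e" for x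
        using cINF_less_iff[OF E(2) bd, of x "\<psi> x + e"] \<open>e > 0\<close> by (force simp: \<psi>_def)
      obtain q r q' r' where qr: "(q, r) \<in> E" "P (q + x) + r < \<psi> x + e"
        and qr': "(q', r') \<in> E" "P (q' + y) + r' < \<psi> y + e"
        using ex[of x] ex[of y] by auto
      have "u *\<^sub>R (q, r) + v *\<^sub>R (q', r') \<in> E"
        using uv by (intro convexD[OF E(1) qr(1) qr'(1)]) auto
      then have "\<psi> (u *\<^sub>R x + v *\<^sub>R y) \<le> P ((u *\<^sub>R q + v *\<^sub>R q') + (u *\<^sub>R x + v *\<^sub>R y)) + (u * r + v * r')"
        by (intro le) simp
      also have "(u *\<^sub>R q + v *\<^sub>R q') + (u *\<^sub>R x + v *\<^sub>R y) = u *\<^sub>R (q + x) + v *\<^sub>R (q' + y)"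
        by (simp add: algebra_simps)
      also have "P \<dots> \<le> u * P (q + x) + v * P (q' + y)"
        by (rule conv2[OF uv])
      finally have "\<psi> (u *\<^sub>R x + v *\<^sub>R y) \<le> u * (P (q + x) + r) + v * (P (q' + y) + r')"
        by (simp add: algebra_simps)
      also have "\<dots> \<le> u * (\<psi> x + e) + v * (\<psi> y + e)"
        by (intro add_mono mult_left_mono uv less_imp_le[OF qr(2)] less_imp_le[OF qr'(2)])
      also have "\<dots> = u * \<psi> x + v * \<psi> y + (u + v) * e"
        by (simp add: algebra_simps)
      finally show "\<psi> (u *\<^sub>R x + v *\<^sub>R y) \<le> u * \<psi> x + v * \<psi> y + e"
        using uv by simp
    qed
  qed simp
  moreover have "0 \<le> \<psi> 0"
    unfolding \<psi>_def using E(2) nonneg by (intro cINF_greatest) (auto simp: add.commute)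
  ultimately obtain m where m: "linear m" "m \<le> \<psi>"
    by (rule convex_linear_minorant)
  interpret linear m by fact
  have mle: "m w \<le> P (q + w) + r" if "(q, r) \<in> E" for q r w
    using le[OF that, of w] le_funD[OF m(2), of w] by simp
  obtain d where d: "d > 0" "\<And>x. norm x < d \<Longrightarrow> P (q0 + x) < P q0 + 1"
  proof -
    obtain d where d: "d > 0" "\<And>x. dist x q0 < d \<Longrightarrow> dist (P x) (P q0) < 1"
      using P(2)[unfolded continuous_on_iff] by (meson UNIV_I zero_less_one)
    have "P (q0 + x) < P q0 + 1" if "norm x < d" for x
      using d(2)[of "q0 + x"] that by (simp add: dist_norm abs_less_iff)
    with d(1) show thesis by (rule that)
  qed
  have "bounded_linear m"
    using mle[OF qr0] d by (intro linear_bounded_above_imp_bounded_linear[OF m(1) d(1), of "P q0 + 1 + r0"])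
      (metis add_le_cancel_right less_imp_le order_trans)
  then have bl: "blinfun_apply (Blinfun m) = m"
    by (rule bounded_linear_Blinfun_apply)
  define \<sigma> where "\<sigma> = (INF v. P v - m v)"
  have bound: "- r - m q \<le> P v - m v" if "(q, r) \<in> E" for q r v
    using mle[OF that, of "v - q"] by (simp add: diff)
  have bd\<sigma>: "bdd_below (range (\<lambda>v. P v - m v))"
    using bound[OF qr0] by (auto intro!: bdd_belowI)
  show thesis
  proof (rule that[of "- Blinfun m" \<sigma>])
    fix q r assume "(q, r) \<in> E"
    then have "- r - m q \<le> \<sigma>"
      unfolding \<sigma>_def using bound by (intro cINF_greatest) auto
    then show "(- Blinfun m) q - \<sigma> \<le> r"
      by (simp add: blinfun.minus_left bl)
  next
    fix q
    have "\<sigma> \<le> P q - m q"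
      unfolding \<sigma>_def by (rule cINF_lower[OF bd\<sigma>]) simp
    then show "0 \<le> (- Blinfun m) q - \<sigma> + P q"
      by (simp add: blinfun.minus_left bl)
  qed
qed

section \<open>Couplings and biduals\<close>

lemma canon_apply [simp]: "blinfun_apply (canon y) f = blinfun_apply f y"
  by (simp add: canon_def bounded_linear_Blinfun_apply blinfun.bounded_linear_left)

text \<open>An approximate value of the negative duality map at \<open>v\<close>; the slack
  \<open>e\<close> replaces norm attainment.\<close>

lemma blinfun_near_dual:
  fixes v :: "'v::real_normed_vector \<Rightarrow>\<^sub>L real"
  assumes "0 < e"
  obtains w where "norm w \<le> norm v" "v w \<le> - (norm v)\<^sup>2 + e"
proof (cases "v = 0")
  case True
  then show thesis using that[of 0] assms by simp
next
  case False
  \<comment> \<open>Just below the norm of \<open>v\<close>, hence not a bound for \<open>v\<close>;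
    the amount is chosen so that \<open>norm v * k\<close> misses the squared norm by exactly
    \<open>e\<close>.\<close>
  define k where "k = norm v - e / norm v"
  have nv: "norm v > 0" using False by simp
  then have k: "norm v * k = (norm v)\<^sup>2 - e"
    by (simp add: k_def algebra_simps power2_eq_square)
  have "\<exists>x. k * norm x < \<bar>v x\<bar>"
  proof (rule ccontr)
    assume "\<nexists>x. k * norm x < \<bar>v x\<bar>"
    then have *: "norm (v x) \<le> k * norm x" for x
      by (simp add: not_less)
    obtain y where "v y \<noteq> 0"
      using False by (metis blinfun_eqI zero_blinfun.rep_eq)
    then have "0 \<le> k"
      using *[of y] zero_le_mult_iff[of k "norm y"] by (cases "y = 0") (auto intro: order_trans[OF abs_ge_zero])
    then have "norm v \<le> k" by (rule norm_blinfun_bound[OF _ *])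
    then show False using nv assms by (simp add: k_def field_simps)
  qed
  then obtain x where x: "k * norm x < \<bar>v x\<bar>" by blast
  then have "x \<noteq> 0" by auto
  define w where "w = (- sgn (v x) * norm v / norm x) *\<^sub>R x"
  have "v w = - (\<bar>v x\<bar> * norm v / norm x)"
    by (simp add: w_def blinfun.scaleR_right blinfun.minus_right abs_sgn)
  also have "\<dots> \<le> - (k * norm v)"
    using x \<open>x \<noteq> 0\<close> nv by (simp add: field_simps)
  finally have "v w \<le> - (norm v)\<^sup>2 + e" using k by (simp add: mult.commute)
  moreover have "norm w \<le> norm v"
    using \<open>x \<noteq> 0\<close> by (simp add: w_def abs_mult abs_sgn_eq)
  ultimately show thesis by (rule that[rotated])
qed

text \<open>A near-minimizer of the squared residual on the ball satisfies a first-order condition,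
  which forces its residual to be small; no separation theorem is needed.\<close>

lemma goldstine:
  fixes u :: "('v::real_normed_vector \<Rightarrow>\<^sub>L real) \<Rightarrow>\<^sub>L real"
  assumes J: "finite J" and e: "0 < e"
  obtains x where "norm x \<le> norm u" "(\<Sum>f\<in>J. (u f - blinfun_apply f x)\<^sup>2) < e"
proof -
  define B where "B = norm u"
  define F where "F x = (\<Sum>f\<in>J. (u f - blinfun_apply f x)\<^sup>2)" for x
  define K where "K = (\<Sum>f\<in>J. (2 * norm f * B)\<^sup>2)"
  \<comment> \<open>\<open>t\<close> is the step length and its square the precision of the
    near-minimizer, so an error of order \<open>t\<close> remains after division by
    \<open>t\<close>.\<close>
  define t where "t = min 1 (e / (2 + K))"
  have K0: "0 \<le> K" unfolding K_def by (intro sum_nonneg) simp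
  have t: "0 < t" "t \<le> 1" "t * (2 + K) \<le> e"
    using K0 e pos_le_divide_eq[of "2 + K" t e] by (auto simp: t_def)
  have bd: "bdd_below (F ` cball 0 B)"
    by (rule bdd_belowI[of _ 0]) (auto simp: F_def sum_nonneg)
  have ne: "cball (0::'v) B \<noteq> {}" by (simp add: B_def)
  define m where "m = (INF x\<in>cball 0 B. F x)"
  have m_le: "m \<le> F x" if "norm x \<le> B" for x
    unfolding m_def using that by (intro cINF_lower[OF bd]) simp
  obtain x where x: "norm x \<le> B" "F x < m + t\<^sup>2"
    using cINF_less_iff[OF ne bd, of "m + t\<^sup>2"] t by (auto simp: m_def)
  \<comment> \<open>The derivative of \<open>F\<close> at \<open>x\<close> in direction
    \<open>d\<close> is \<open>- 2 * g d\<close>.\<close>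
  define g where "g = (\<Sum>f\<in>J. (u f - blinfun_apply f x) *\<^sub>R f)"
  have gy: "g y = (\<Sum>f\<in>J. (u f - blinfun_apply f x) * blinfun_apply f y)" for y
    by (simp add: g_def blinfun.sum_left blinfun.scaleR_left)
  have ug: "u g = (\<Sum>f\<in>J. (u f - blinfun_apply f x) * u f)"
    by (simp add: g_def blinfun.sum_right blinfun.scaleR_right)
  have first: "2 * g (y - x) \<le> t * (1 + K)" if y: "norm y \<le> B" for y
  proof -
    have "norm ((1 - t) *\<^sub>R x + t *\<^sub>R y) \<le> (1 - t) * B + t * B"
      using t x y by (intro order_trans[OF norm_triangle_ineq] add_mono) (auto intro: mult_left_mono)
    then have "norm (x + t *\<^sub>R (y - x)) \<le> B"
      by (simp add: algebra_simps)
    then have "m \<le> F (x + t *\<^sub>R (y - x))" by (rule m_le)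
    also have "\<dots> = F x - 2 * t * g (y - x) + t\<^sup>2 * (\<Sum>f\<in>J. (blinfun_apply f (y - x))\<^sup>2)"
    proof -
      have "(a - (b + t * d))\<^sup>2 = (a - b)\<^sup>2 - 2 * t * ((a - b) * d) + t\<^sup>2 * d\<^sup>2" for a b d
        by (simp add: power2_eq_square algebra_simps)
      then show ?thesis
        unfolding F_def gy sum_distrib_left sum_subtractf[symmetric] sum.distrib[symmetric]
        by (simp only: blinfun.add_right blinfun.scaleR_right real_scaleR_def)
    qed
    also have "(\<Sum>f\<in>J. (blinfun_apply f (y - x))\<^sup>2) \<le> K"
      unfolding K_def
    proof (rule sum_mono)
      fix f assume "f \<in> J"
      have "norm (y - x) \<le> 2 * B"
        using norm_triangle_ineq4[of y x] x(1) y by linarith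
      then have "\<bar>blinfun_apply f (y - x)\<bar> \<le> norm f * (2 * B)"
        using norm_blinfun[of f "y - x"] by (smt (verit) mult_left_mono norm_ge_zero real_norm_def)
      then show "(blinfun_apply f (y - x))\<^sup>2 \<le> (2 * norm f * B)\<^sup>2"
        by (intro abs_le_square_iff[THEN iffD1]) (auto simp: B_def abs_mult)
    qed
    finally have "0 \<le> t\<^sup>2 - 2 * t * g (y - x) + t\<^sup>2 * K"
      using x(2) t by (simp add: mult_left_mono)
    also have "\<dots> = t * (t * (1 + K) - 2 * g (y - x))"
      by (simp add: power2_eq_square algebra_simps)
    finally show ?thesis using t by (simp add: zero_le_mult_iff)
  qed
  \<comment> \<open>A point of the ball at which \<open>g\<close> nearly attains its maximum
    \<open>B * norm g\<close>; the first-order condition is used towards it.\<close>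
  obtain y where y: "norm y \<le> B" "B * norm g \<le> g y + t / 2"
  proof -
    have "\<exists>w. norm w \<le> B \<and> B * norm g - t / 2 \<le> g w"
    proof (cases "norm g = 0")
      case True
      then show ?thesis using t by (intro exI[of _ 0]) (simp add: B_def)
    next
      case False
      then have ng: "norm g > 0" by simp
      have "0 < t * norm g / (2 * (B + 1))"
        using t ng by (simp add: B_def add_nonneg_pos)
      then obtain w where w: "norm w \<le> norm g" "g w \<le> - (norm g)\<^sup>2 + t * norm g / (2 * (B + 1))"
        by (rule blinfun_near_dual)
      have "norm (- ((B / norm g) *\<^sub>R w)) \<le> B"
        using w(1) ng by (simp add: B_def field_simps mult_right_mono)
      moreover have "B * norm g - t / 2 \<le> g (- ((B / norm g) *\<^sub>R w))"
      proof -
        have "(B / norm g) * g w \<le> (B / norm g) * (- (norm g)\<^sup>2 + t * norm g / (2 * (B + 1)))"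
          using w(2) ng by (intro mult_left_mono) (auto simp: B_def)
        also have "\<dots> = - (B * norm g) + (t / 2) * (B / (B + 1))"
        proof -
          have "(B / n) * (- n\<^sup>2 + t * n / (2 * c)) = - (B * n) + (t / 2) * (B / c)"
            if "n > 0" "c > 0" for n c
            using that by (simp add: field_simps power2_eq_square)
          from this[OF ng, of "B + 1"] show ?thesis by (simp only: B_def add_nonneg_pos norm_ge_zero zero_less_one)
        qed
        also have "(t / 2) * (B / (B + 1)) \<le> (t / 2) * 1"
          using t by (intro mult_left_mono) (auto simp: B_def divide_simps add_nonneg_pos not_less)
        finally show ?thesis by (simp add: blinfun.minus_right blinfun.scaleR_right)
      qed
      ultimately show ?thesis by blast
    qed
    then show thesis by (auto intro: that)
  qed
  have "F x = u g - g x"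
    unfolding F_def ug gy sum_subtractf[symmetric]
    by (intro sum.cong refl) (simp add: power2_eq_square algebra_simps)
  also have "u g \<le> B * norm g"
    using norm_blinfun[of u g] by (simp add: B_def)
  also have "B * norm g - g x \<le> g (y - x) + t / 2"
    using y(2) by (simp add: blinfun.diff_right)
  also have "\<dots> \<le> t * (1 + K) / 2 + t / 2"
    using first[OF y(1)] by simp
  also have "\<dots> = t * (2 + K) / 2" by (simp add: field_simps)
  also have "\<dots> < e" using t e by linarith
  finally show thesis
    using that x(1) by (simp add: B_def F_def)
qed

text \<open>Biduals enter here: a functional on a space times its dual is a pair from the dual and
  the bidual.\<close>

lemma blinfun_prod_split:
  fixes l :: "('a::real_normed_vector \<times> 'b::real_normed_vector) \<Rightarrow>\<^sub>L real"
  obtains v u where "\<And>x y. l (x, y) = blinfun_apply v x + blinfun_apply u y"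
proof -
  have 1: "bounded_linear (\<lambda>x. l (x, 0))" and 2: "bounded_linear (\<lambda>y. l (0, y))"
    by (intro bounded_linear_compose[OF blinfun.bounded_linear_right] bounded_linear_Pair
        bounded_linear_ident bounded_linear_zero)+
  have "l (x, y) = Blinfun (\<lambda>x. l (x, 0)) x + Blinfun (\<lambda>y. l (0, y)) y" for x y
    unfolding bounded_linear_Blinfun_apply[OF 1] bounded_linear_Blinfun_apply[OF 2]
    using blinfun.add_right[of l "(x, 0)" "(0, y)"] by simp
  then show thesis by (rule that)
qed

text \<open>The coupling is a quadratic form, so its convexity defect on a segment is a multiple of
  its value at the difference. This converts convexity into monotonicity.\<close>

lemma coupling_convex_comb:
  assumes "s + t = 1"
  shows "coupling (s *\<^sub>R p + t *\<^sub>R q) = s * coupling p + t * coupling q - s * t * coupling (p - q)"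
proof -
  have s: "s = 1 - t" using assms by simp
  show ?thesis unfolding s
    by (simp add: coupling_def blinfun.bilinear_simps algebra_simps)
qed

lemma norm_prod_power2: "(norm p)\<^sup>2 = (norm (fst p))\<^sup>2 + (norm (snd p))\<^sup>2"
  by (simp add: norm_prod_def)

lemma abs_coupling_le: "\<bar>coupling p\<bar> \<le> (norm p)\<^sup>2 / 2"
proof -
  have "\<bar>coupling p\<bar> \<le> norm (snd p) * norm (fst p)"
    using norm_blinfun[of "snd p" "fst p"] by (simp add: coupling_def)
  also have "\<dots> \<le> (norm p)\<^sup>2 / 2"
    using sum_squares_bound[of "norm (fst p)" "norm (snd p)"]
    by (simp add: norm_prod_power2 algebra_simps)
  finally show ?thesis .
qed

lemma coupling_add: "coupling (p + q) = coupling p + coupling q + blinfun_apply (snd p) (fst q) + blinfun_apply (snd q) (fst p)"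
  by (simp add: coupling_def blinfun.bilinear_simps)

lemma abs_cross_le: "\<bar>blinfun_apply (snd p) (fst q)\<bar> \<le> norm p * norm q"
proof -
  have "\<bar>blinfun_apply (snd p) (fst q)\<bar> \<le> norm (snd p) * norm (fst q)"
    using norm_blinfun[of "snd p" "fst q"] by simp
  also have "\<dots> \<le> norm p * norm q"
    using dist_fst_le[of q 0] dist_snd_le[of p 0] by (intro mult_mono) auto
  finally show ?thesis .
qed

lemma coupling_add_ge: "coupling p - 2 * norm p * norm q - (norm q)\<^sup>2 / 2 \<le> coupling (p + q)"
  using coupling_add[of p q] abs_cross_le[of p q] abs_cross_le[of q p] abs_coupling_le[of q]
  unfolding mult.commute[of "norm q" "norm p"] mult.assoc by linarith

lemma coupling_add_le: "coupling (p + q) \<le> coupling p + 2 * norm p * norm q + (norm q)\<^sup>2 / 2"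
  using coupling_add[of p q] abs_cross_le[of p q] abs_cross_le[of q p] abs_coupling_le[of q]
  unfolding mult.commute[of "norm q" "norm p"] mult.assoc by linarith

lemma coupling_minus [simp]: "coupling (- p) = coupling p"
  by (simp add: coupling_def blinfun.bilinear_simps)

lemma coupling_zero [simp]: "coupling 0 = 0"
  by (simp add: coupling_def)

lemma coupling_minus_commute: "coupling (p - q) = coupling (q - p)"
  using coupling_minus[of "p - q"] by simp

lemma continuous_on_coupling [continuous_intros]:
  "continuous_on S f \<Longrightarrow> continuous_on S (\<lambda>x. coupling (f x))"
  unfolding coupling_def by (intro continuous_intros)

lemma tendsto_coupling [tendsto_intros]:
  "(f \<longlongrightarrow> p) F \<Longrightarrow> ((\<lambda>x. coupling (f x)) \<longlongrightarrow> coupling p) F"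
  unfolding coupling_def by (intro tendsto_intros)

lemma convex_on_half_norm_power2:
  fixes z :: "'v::real_normed_vector"
  shows "convex_on UNIV (\<lambda>q. (norm (q - z))\<^sup>2 / 2)"
  unfolding convex_on_def
proof (intro conjI ballI allI impI)
  fix x y and u v :: real assume uv: "0 \<le> u" "0 \<le> v" "u + v = 1"
  have "u *\<^sub>R x + v *\<^sub>R y - z = u *\<^sub>R (x - z) + v *\<^sub>R (y - z)"
  proof -
    have "u *\<^sub>R x + v *\<^sub>R y - z = u *\<^sub>R x + v *\<^sub>R y - (u + v) *\<^sub>R z"
      using uv(3) by simp
    also have "\<dots> = u *\<^sub>R (x - z) + v *\<^sub>R (y - z)"
      by (simp add: scaleR_add_left scaleR_diff_right)
    finally show ?thesis .
  qed
  then have "norm (u *\<^sub>R x + v *\<^sub>R y - z) \<le> u * norm (x - z) + v * norm (y - z)"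
    using norm_triangle_ineq[of "u *\<^sub>R (x - z)" "v *\<^sub>R (y - z)"] uv by simp
  then have "(norm (u *\<^sub>R x + v *\<^sub>R y - z))\<^sup>2 \<le> (u * norm (x - z) + v * norm (y - z))\<^sup>2"
    by (intro power_mono) auto
  also have "\<dots> \<le> u * (norm (x - z))\<^sup>2 + v * (norm (y - z))\<^sup>2"
  proof -
    have u: "u = 1 - v" using uv(3) by simp
    have *: "u * a\<^sup>2 + v * b\<^sup>2 - (u * a + v * b)\<^sup>2 = u * v * (a - b)\<^sup>2" for a b :: real
      unfolding u by (simp add: power2_eq_square algebra_simps)
    show ?thesis
      by (rule diff_ge_0_iff_ge[THEN iffD1]) (unfold *, simp add: uv(1,2))
  qed
  finally show "(norm (u *\<^sub>R x + v *\<^sub>R y - z))\<^sup>2 / 2 \<le> u * ((norm (x - z))\<^sup>2 / 2) + v * ((norm (y - z))\<^sup>2 / 2)"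
    by simp
qed simp

lemma geometric_increments_convergent:
  fixes X :: "nat \<Rightarrow> 'a::banach"
  assumes step: "\<And>n. norm (X (Suc n) - X n) \<le> C * (1 / 2) ^ n"
  obtains l where "X \<longlonglongrightarrow> l" "norm (l - X 0) \<le> 2 * C"
proof -
  define d where "d n = X (Suc n) - X n" for n
  have g: "summable (\<lambda>n. C * (1 / 2 :: real) ^ n)"
    by (intro summable_mult summable_geometric) simp
  have d: "summable d"
    using step by (intro summable_comparison_test'[OF g, of 0]) (simp add: d_def)
  have "(\<lambda>n. X 0 + (\<Sum>i<n. d i)) \<longlonglongrightarrow> X 0 + suminf d"
    by (intro tendsto_add tendsto_const summable_LIMSEQ d)
  moreover have "X 0 + (\<Sum>i<n. d i) = X n" for n
    using sum_lessThan_telescope[of X n] by (simp add: d_def)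
  ultimately have "X \<longlonglongrightarrow> X 0 + suminf d" by simp
  moreover have "norm (suminf d) \<le> (\<Sum>n. C * (1 / 2) ^ n)"
    using step by (intro norm_suminf_le g) (simp add: d_def)
  then have "norm (X 0 + suminf d - X 0) \<le> 2 * C"
    by (simp add: suminf_mult suminf_geometric summable_geometric)
  ultimately show thesis by (rule that)
qed

lemma nonneg_from_small_perturbation:
  fixes a b c :: real
  assumes "\<And>t. 0 < t \<Longrightarrow> t < 1 \<Longrightarrow> 0 \<le> a + t * b + t\<^sup>2 * c"
  shows "0 \<le> a"
proof (rule tendsto_lowerbound)
  show "((\<lambda>t. a + t * b + t\<^sup>2 * c) \<longlongrightarrow> a) (at_right 0)"
    by (auto intro!: tendsto_eq_intros)
  show "\<forall>\<^sub>F t in at_right 0. 0 \<le> a + t * b + t\<^sup>2 * c"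
    using assms eventually_at_right_real[of 0 1] by (force elim: eventually_mono)
qed simp

section \<open>Convex sets lying above the coupling together with their conjugates\<close>

text \<open>The set \<open>E\<close> plays the role of the epigraph of a convex function \<open>h\<close>: \<open>coupling_le\<close> says
  that \<open>h\<close> majorizes the coupling, \<open>conj_ge\<close> that its conjugate on the dual times the bidual
  does.  The points of \<open>rep_set E\<close> are those at which the conjugate is at most the coupling.\<close>

locale strong_epigraph =
  fixes E :: "(('x::banach \<times> ('x \<Rightarrow>\<^sub>L real)) \<times> real) set"
  assumes convex_E: "convex E"
    and coupling_le: "(p, r) \<in> E \<Longrightarrow> coupling p \<le> r"
    and conj_ge: "(\<And>p r. (p, r) \<in> E \<Longrightarrow> blinfun_apply v (fst p) + blinfun_apply u (snd p) - r \<le> s)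
      \<Longrightarrow> blinfun_apply u v \<le> s"

definition rep_set :: "(('x::banach \<times> ('x \<Rightarrow>\<^sub>L real)) \<times> real) set \<Rightarrow> ('x \<times> ('x \<Rightarrow>\<^sub>L real)) set" where
  "rep_set E = {q. \<forall>(p, r) \<in> E. blinfun_apply (snd q) (fst p) + blinfun_apply (snd p) (fst q) - r \<le> coupling q}"

lemma coupling_diff:
  "coupling (p - q) = coupling p + coupling q - blinfun_apply (snd p) (fst q) - blinfun_apply (snd q) (fst p)"
  by (simp add: coupling_def blinfun.bilinear_simps)

text \<open>In this form membership is monotone relatedness to each \<open>p\<close>, relaxed by the
  gap \<open>r - coupling p\<close>.\<close>

lemma rep_set_iff: "q \<in> rep_set E \<longleftrightarrow> (\<forall>(p, r) \<in> E. 0 \<le> r - coupling p + coupling (p - q))"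
  by (force simp: rep_set_def coupling_diff)

section \<open>Approximate duality and a Broendsted-Rockafellar theorem\<close>

context strong_epigraph
begin

lemma E_nonempty: "E \<noteq> {}"
  \<comment> \<open>For empty \<open>E\<close> the premise of \<open>conj_ge\<close> is vacuous and
    would give \<open>0 \<le> -1\<close>.\<close>
  using conj_ge[of 0 0 "-1"] by auto

text \<open>Were the expression at least \<open>\<eta>\<close> on all of \<open>E\<close>, the
  sandwich theorem would give \<open>(v, u)\<close> and \<open>\<sigma>\<close>, and
  \<open>conj_ge\<close> the bound \<open>u v \<le> \<sigma>\<close>. Testing the other half of the
  sandwich at \<open>z\<close> plus approximate negative duality vectors contradicts
  \<open>- (norm u' * norm v') \<le> u' v'\<close>.\<close>

lemma exists_near:
  assumes "0 < \<eta>"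
  obtains q r where "(q, r) \<in> E" "r - coupling q + coupling (q - z) + (norm (q - z))\<^sup>2 / 2 < \<eta>"
proof (rule ccontr)
  assume none: "\<not> thesis"
  \<comment> \<open>The quadratic parts of \<open>coupling (q - z)\<close> and
    \<open>coupling q\<close> cancel; this form exhibits the remainder as affine, so that
    \<open>P\<close> is convex.\<close>
  define P where "P q = (- blinfun_apply (snd q) (fst z) - blinfun_apply (snd z) (fst q) + coupling z - \<eta>)
    + (norm (q - z))\<^sup>2 / 2" for q
  have P_eq: "P q = coupling (q - z) - coupling q - \<eta> + (norm (q - z))\<^sup>2 / 2" for q
    by (simp add: P_def coupling_diff)
  have nonneg: "0 \<le> r + P q" if "(q, r) \<in> E" for q r
    using none that \<open>\<And>q r. (q, r) \<in> E \<Longrightarrow> _ \<Longrightarrow> thesis\<close>[of q r] by (force simp: P_eq not_less)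
  have cvx: "convex_on UNIV P"
    unfolding P_def
  proof (intro convex_on_add convex_on_half_norm_power2)
    show "convex_on UNIV (\<lambda>q. - blinfun_apply (snd q) (fst z) - blinfun_apply (snd z) (fst q) + coupling z - \<eta>)"
      unfolding convex_on_def
    proof (intro conjI ballI allI impI)
      fix x y :: "'x \<times> ('x \<Rightarrow>\<^sub>L real)" and a b :: real assume "0 \<le> a" "0 \<le> b" "a + b = 1"
      then have a: "a = 1 - b" by simp
      show "- blinfun_apply (snd (a *\<^sub>R x + b *\<^sub>R y)) (fst z) - blinfun_apply (snd z) (fst (a *\<^sub>R x + b *\<^sub>R y)) + coupling z - \<eta>
        \<le> a * (- blinfun_apply (snd x) (fst z) - blinfun_apply (snd z) (fst x) + coupling z - \<eta>)
        + b * (- blinfun_apply (snd y) (fst z) - blinfun_apply (snd z) (fst y) + coupling z - \<eta>)"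
        unfolding a by (simp add: blinfun.bilinear_simps algebra_simps)
    qed simp
  qed
  have cont: "continuous_on UNIV P"
    unfolding P_eq by (intro continuous_intros) auto
  obtain l \<sigma> where l: "\<And>q r. (q, r) \<in> E \<Longrightarrow> blinfun_apply l q - \<sigma> \<le> r"
    and lP: "\<And>q. 0 \<le> blinfun_apply l q - \<sigma> + P q"
    using convex_sandwich[OF convex_E E_nonempty cvx cont nonneg] by blast
  obtain v u where vu: "\<And>x y. l (x, y) = blinfun_apply v x + blinfun_apply u y"
    using blinfun_prod_split by blast
  have "u v \<le> \<sigma>"
    using l vu by (intro conj_ge) force
  define v' where "v' = v - snd z"
  define u' where "u' = u - canon (fst z)"
  obtain w where w: "norm w \<le> norm v'" "v' w \<le> - (norm v')\<^sup>2 + \<eta> / 4"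
    using blinfun_near_dual[of "\<eta> / 4"] assms by auto
  obtain w' where w': "norm w' \<le> norm u'" "u' w' \<le> - (norm u')\<^sup>2 + \<eta> / 4"
    using blinfun_near_dual[of "\<eta> / 4"] assms by auto
  have "0 \<le> l (z + (w, w')) - \<sigma> + P (z + (w, w'))" by (rule lP)
  also have "l (z + (w, w')) = blinfun_apply v (fst z + w) + blinfun_apply u (snd z + w')"
    using vu[of "fst z + w" "snd z + w'"] by (cases z) simp
  finally have "u' v' \<le> v' w + u' w' + ((norm w)\<^sup>2 + (norm w')\<^sup>2) / 2 - \<eta>"
    using \<open>u v \<le> \<sigma>\<close>
    by (simp add: P_def norm_prod_power2 u'_def v'_def coupling_def blinfun.bilinear_simps)
  moreover have "(norm w)\<^sup>2 \<le> (norm v')\<^sup>2" "(norm w')\<^sup>2 \<le> (norm u')\<^sup>2"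
    using w w' by (auto intro: power_mono)
  moreover have "- (norm u' * norm v') \<le> u' v'"
    using norm_blinfun[of u' v'] by (simp add: abs_le_iff)
  moreover have "norm u' * norm v' \<le> ((norm v')\<^sup>2 + (norm u')\<^sup>2) / 2"
    using sum_squares_bound[of "norm u'" "norm v'"] by (simp add: algebra_simps)
  ultimately show False
    using w(2) w'(2) assms by argo
qed

text \<open>The midpoint also lies above the coupling, so points of \<open>E\<close> with small gaps
  are nearly monotonically related.\<close>

lemma coupling_diff_ge:
  assumes "(q, r) \<in> E" "(q', r') \<in> E"
  shows "- 2 * ((r - coupling q) + (r' - coupling q')) \<le> coupling (q - q')"
proof -
  have "(1/2) *\<^sub>R (q, r) + (1/2) *\<^sub>R (q', r') \<in> E"
    by (rule convexD[OF convex_E assms]) auto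
  then have "coupling ((1/2) *\<^sub>R q + (1/2) *\<^sub>R q') \<le> r / 2 + r' / 2"
    by (intro coupling_le) simp
  then show ?thesis
    by (simp add: coupling_convex_comb)
qed

text \<open>Without closedness of \<open>E\<close> the limit is compared with an arbitrary
  \<open>(p, r')\<close> along the segment joining them; dividing by \<open>t\<close> and letting
  \<open>t\<close> tend to 0 leaves the claim.\<close>

lemma limit_in_rep_set:
  assumes E: "\<And>n. (q n, r n) \<in> E" and lim: "q \<longlonglongrightarrow> q'" "r \<longlonglongrightarrow> coupling q'"
  shows "q' \<in> rep_set E"
  unfolding rep_set_iff
proof clarify
  fix x xs r' assume p: "((x, xs), r') \<in> E"
  let ?p = "(x, xs)"
  have "0 \<le> (r' - coupling ?p + coupling (?p - q')) + t * - coupling (?p - q') + t\<^sup>2 * 0"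
    if t: "0 < t" "t < 1" for t
  proof -
    have "coupling (t *\<^sub>R ?p + (1 - t) *\<^sub>R q n) \<le> t * r' + (1 - t) * r n" for n
      using convexD[OF convex_E p E[of n], of t "1 - t"] t by (intro coupling_le) simp
    then have "coupling (t *\<^sub>R ?p + (1 - t) *\<^sub>R q') \<le> t * r' + (1 - t) * coupling q'"
      by (intro LIMSEQ_le[of "\<lambda>n. coupling (t *\<^sub>R ?p + (1 - t) *\<^sub>R q n)" _ "\<lambda>n. t * r' + (1 - t) * r n"])
        (auto intro!: tendsto_intros lim)
    moreover have "coupling (t *\<^sub>R ?p + (1 - t) *\<^sub>R q') =
        t * coupling ?p + (1 - t) * coupling q' - t * (1 - t) * coupling (?p - q')"
      by (rule coupling_convex_comb) simp
    ultimately have "0 \<le> t * (r' - coupling ?p + (1 - t) * coupling (?p - q'))"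
      by (simp add: algebra_simps del: scaleR_Pair)
    then have "0 \<le> r' - coupling ?p + (1 - t) * coupling (?p - q')"
      using t by (simp only: zero_le_mult_iff) auto
    then show ?thesis by (simp add: algebra_simps)
  qed
  then show "0 \<le> r' - coupling ?p + coupling (?p - q')"
    by (rule nonneg_from_small_perturbation)
qed

text \<open>Each step applies \<open>exists_near\<close> around the current point with a quarter of
  the gap. By \<open>coupling_diff_ge\<close> the step length is controlled by the square root of
  the gap, so it halves and the sequence converges; the first step \<open>3 * sqrt e\<close> doubles
  in the sum.\<close>

lemma broendsted_rockafellar:
  assumes E0: "(q0, r0) \<in> E" "r0 \<le> coupling q0 + e" and "0 < e"
  obtains q where "q \<in> rep_set E" "norm (q - q0) \<le> 6 * sqrt e"
proof -
  \<comment> \<open>The clause for \<open>n = 0\<close> pins the start, since dependent choice alone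
    returns some sequence and the distance to \<open>q0\<close> would be lost.\<close>
  define P where "P n x \<longleftrightarrow> x \<in> E \<and> snd x \<le> coupling (fst x) + e * (1/4)^n \<and> (n = 0 \<longrightarrow> x = (q0, r0))"
    for n :: nat and x
  define Q where "Q n x y \<longleftrightarrow> norm (fst y - fst x) \<le> (3 * sqrt e) * (1/2)^n"
    for n :: nat and x y :: "('x \<times> ('x \<Rightarrow>\<^sub>L real)) \<times> real"
  have "\<exists>f. \<forall>n. P n (f n) \<and> Q n (f n) (f (Suc n))"
  proof (rule dependent_nat_choice)
    show "\<exists>x. P 0 x" using E0 by (intro exI[of _ "(q0, r0)"]) (simp add: P_def)
  next
    fix x n assume "P n x"
    obtain q r where x: "x = (q, r)" by (cases x)
    with \<open>P n x\<close> have qr: "(q, r) \<in> E" "r - coupling q \<le> e * (1/4)^n" by (auto simp: P_def)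
    have quarter: "e * (1/4)^Suc n = e * (1/4)^n / 4" by simp
    have pos: "0 < e * (1/4)^Suc n" using \<open>0 < e\<close> by simp
    then obtain q' r' where qr': "(q', r') \<in> E"
      and near: "r' - coupling q' + coupling (q' - q) + (norm (q' - q))\<^sup>2 / 2 < e * (1/4)^Suc n"
      by (rule exists_near)
    have r': "r' - coupling q' \<le> e * (1/4)^Suc n"
      using near abs_coupling_le[of "q' - q"] by linarith
    \<comment> \<open>The inequalities give the factor 5.5; it is rounded up to the square
      9.\<close>
    have "(norm (q' - q))\<^sup>2 \<le> 9 * (e * (1/4)^n)"
      using near r' qr(2) coupling_diff_ge[OF qr' qr(1)] coupling_le[OF qr'] pos
      unfolding quarter by (simp only: mult_minus_left) argo
    moreover have "(1/4)^n = ((1/2 :: real)^n)\<^sup>2"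
      by (induction n) (simp_all add: power_mult_distrib power2_eq_square)
    moreover have "((3 * sqrt e) * c)\<^sup>2 = 9 * (e * c\<^sup>2)" for c
      using \<open>0 < e\<close> by (simp add: power_mult_distrib)
    ultimately have "(norm (q' - q))\<^sup>2 \<le> ((3 * sqrt e) * (1/2)^n)\<^sup>2"
      by (simp only:)
    then have "norm (q' - q) \<le> (3 * sqrt e) * (1/2)^n"
      by (rule power2_le_imp_le) (use \<open>0 < e\<close> in simp)
    then show "\<exists>y. P (Suc n) y \<and> Q n x y"
      using qr' r' by (intro exI[of _ "(q', r')"]) (simp add: P_def Q_def x)
  qed
  then obtain f where f: "\<And>n. P n (f n)" "\<And>n. Q n (f n) (f (Suc n))" by blast
  obtain q where q: "(\<lambda>n. fst (f n)) \<longlonglongrightarrow> q" "norm (q - fst (f 0)) \<le> 2 * (3 * sqrt e)"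
    using geometric_increments_convergent[of "\<lambda>n. fst (f n)" "3 * sqrt e"] f(2) by (auto simp: Q_def)
  have "(\<lambda>n. coupling (fst (f n)) + e * (1/4)^n) \<longlonglongrightarrow> coupling q + e * 0"
    by (intro tendsto_intros q LIMSEQ_power_zero) simp
  then have up: "(\<lambda>n. coupling (fst (f n)) + e * (1/4)^n) \<longlonglongrightarrow> coupling q" by simp
  have "coupling (fst (f n)) \<le> snd (f n)" "snd (f n) \<le> coupling (fst (f n)) + e * (1/4)^n" for n
    using f(1)[of n] coupling_le[of "fst (f n)" "snd (f n)"] by (simp_all add: P_def)
  then have "(\<lambda>n. snd (f n)) \<longlonglongrightarrow> coupling q"
    by (intro tendsto_sandwich[OF _ _ tendsto_coupling[OF q(1)] up]) simp_all
  then have "q \<in> rep_set E"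
    using f(1) q(1) by (intro limit_in_rep_set[of "\<lambda>n. fst (f n)" "\<lambda>n. snd (f n)"]) (auto simp: P_def)
  moreover have "f 0 = (q0, r0)" using f(1)[of 0] by (simp add: P_def)
  ultimately show thesis using that q(2) by simp
qed

text \<open>A point from \<open>exists_near\<close> with precision \<open>s\<close> squared is moved
  into the touching set by at most \<open>6 * s\<close>. The change of the expression is
  proportional to the distance from \<open>z\<close>, which must therefore be bounded independently
  of \<open>s\<close>, by comparison with a fixed point \<open>p0\<close> of
  \<open>E\<close>.\<close>

lemma exists_near_rep_set:
  assumes "0 < \<eta>"
  obtains q where "q \<in> rep_set E" "coupling (q - z) + (norm (q - z))\<^sup>2 / 2 < \<eta>"
proof -
  obtain p0 s0 where p0: "(p0, s0) \<in> E" using E_nonempty by auto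
  define a where "a = s0 - coupling p0"
  define k where "k = norm (p0 - z)"
  \<comment> \<open>For \<open>d\<close> at least 1, monotone relatedness to \<open>p0\<close>
    bounds the square of \<open>d\<close> by \<open>6 + 4 * a + 4 * d * k\<close> plus five times
    the square of \<open>k\<close>; dividing by \<open>d\<close> gives \<open>D\<close>.\<close>
  define D where "D = 6 + 4 * a + 5 * k\<^sup>2 + 4 * k"
  \<comment> \<open>The total error is at most \<open>s\<close> from \<open>exists_near\<close>,
    \<open>3 * D * (6 * s)\<close> from the cross terms and \<open>36 * s\<close> from the squared
    displacement.\<close>
  define s where "s = min 1 (\<eta> / (37 + 18 * D))"
  have a: "0 \<le> a" using coupling_le[OF p0] by (simp add: a_def)
  have k: "0 \<le> k" by (simp add: k_def)
  have D: "4 \<le> D" using a k by (simp add: D_def)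
  have s: "0 < s" "s \<le> 1" "s * (37 + 18 * D) \<le> \<eta>"
    using D assms pos_le_divide_eq[of "37 + 18 * D" s \<eta>] by (auto simp: s_def)
  then have "0 < s\<^sup>2" by simp
  then obtain q1 r1 where q1: "(q1, r1) \<in> E"
    and near: "r1 - coupling q1 + coupling (q1 - z) + (norm (q1 - z))\<^sup>2 / 2 < s\<^sup>2"
    by (rule exists_near)
  have s2: "s\<^sup>2 \<le> s" "s\<^sup>2 \<le> 1" using s by (auto simp: power2_eq_square mult_le_one)
  have r1: "r1 - coupling q1 \<le> s\<^sup>2"
    using near abs_coupling_le[of "q1 - z"] by linarith
  define d where "d = norm (q1 - z)"
  have "d \<le> D"
  proof (cases "d < 1")
    case False
    have "coupling (q1 - p0) - 2 * norm (q1 - p0) * k - k\<^sup>2 / 2 \<le> coupling (q1 - z)"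
      using coupling_add_ge[of "q1 - p0" "p0 - z"] by (simp add: k_def)
    moreover have "- 2 * (1 + a) \<le> coupling (q1 - p0)"
      using coupling_diff_ge[OF q1 p0] r1 s2 by (simp add: a_def)
    moreover have "norm (q1 - p0) * k \<le> (d + k) * k"
      using norm_triangle_ineq4[of "q1 - z" "p0 - z"] k
      by (intro mult_right_mono) (auto simp: d_def k_def)
    ultimately have "d\<^sup>2 \<le> 6 + 4 * a + 4 * (d * k) + 5 * k\<^sup>2"
      using near r1 s2 coupling_le[OF q1] by (simp add: d_def power2_eq_square algebra_simps)
    also have "\<dots> \<le> d * D"
    proof -
      have "1 * (6 + 4 * a + 5 * k\<^sup>2) \<le> d * (6 + 4 * a + 5 * k\<^sup>2)"
        using False a by (intro mult_right_mono) auto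
      then show ?thesis by (simp add: D_def algebra_simps)
    qed
    finally show ?thesis
      using False by (simp add: power2_eq_square)
  qed (use D in linarith)
  from q1 have "\<exists>q\<in>rep_set E. norm (q - q1) \<le> 6 * s"
    using broendsted_rockafellar[OF q1, of "s\<^sup>2"] r1 s by (force simp: real_sqrt_abs)
  then obtain q where q: "q \<in> rep_set E" "norm (q - q1) \<le> 6 * s" by blast
  define e where "e = norm (q - q1)"
  have "coupling (q - z) \<le> coupling (q1 - z) + 2 * d * e + e\<^sup>2 / 2"
    using coupling_add_le[of "q1 - z" "q - q1"] by (simp add: d_def e_def)
  moreover have "norm (q - z) \<le> d + e"
    using norm_triangle_ineq[of "q1 - z" "q - q1"] by (simp add: d_def e_def)
  then have "(norm (q - z))\<^sup>2 \<le> (d + e)\<^sup>2"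
    by (intro power_mono) auto
  ultimately have "coupling (q - z) + (norm (q - z))\<^sup>2 / 2 < s\<^sup>2 + 3 * (d * e) + e\<^sup>2"
    using near coupling_le[OF q1] by (simp add: d_def power2_eq_square algebra_simps)
  moreover have "d * e \<le> D * (6 * s)"
    using \<open>d \<le> D\<close> q(2) D by (intro mult_mono) (auto simp: e_def)
  moreover have "e\<^sup>2 \<le> (6 * s)\<^sup>2"
    using q(2) by (intro power_mono) (auto simp: e_def)
  moreover have "s\<^sup>2 + 3 * (D * (6 * s)) + (6 * s)\<^sup>2 \<le> s * (37 + 18 * D)"
    using s2 by (simp add: power_mult_distrib algebra_simps)
  ultimately have "coupling (q - z) + (norm (q - z))\<^sup>2 / 2 < \<eta>"
    using s(3) by linarith
  with q(1) show thesis by (rule that)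
qed

end

section \<open>Maximal monotonicity and negative infimum of the touching set\<close>

lemma canon_diff_apply:
  "blinfun_apply (canon (fst q) - u) (snd q - v)
    = coupling q - blinfun_apply v (fst q) - blinfun_apply u (snd q) + blinfun_apply u v"
  by (simp add: coupling_def blinfun.bilinear_simps)

context strong_epigraph
begin

text \<open>The midpoint argument of \<open>coupling_diff_ge\<close> on the dual side: the conjugate
  at the midpoint is at most the mean of the couplings and, by \<open>conj_ge\<close>, at least the
  coupling.\<close>

lemma rep_set_monotone:
  assumes "q \<in> rep_set E" "q' \<in> rep_set E"
  shows "0 \<le> coupling (q - q')"
proof -
  let ?m = "(1/2) *\<^sub>R q + (1/2) *\<^sub>R q'"
  have "blinfun_apply (canon (fst ?m)) (snd ?m) \<le> (coupling q + coupling q') / 2"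
  proof (rule conj_ge)
    fix p r assume "(p, r) \<in> E"
    then have "blinfun_apply (snd q) (fst p) + blinfun_apply (snd p) (fst q) - r \<le> coupling q"
      "blinfun_apply (snd q') (fst p) + blinfun_apply (snd p) (fst q') - r \<le> coupling q'"
      using assms by (auto simp: rep_set_def)
    then show "blinfun_apply (snd ?m) (fst p) + blinfun_apply (canon (fst ?m)) (snd p) - r \<le> (coupling q + coupling q') / 2"
      by (simp add: blinfun.bilinear_simps field_simps)
  qed
  then have "coupling ?m \<le> (coupling q + coupling q') / 2"
    by (simp add: coupling_def)
  then show ?thesis
    by (simp add: coupling_convex_comb)
qed

lemma closed_rep_set: "closed (rep_set E)"
proof -
  have "rep_set E = (\<Inter>(p, r)\<in>E. {q. 0 \<le> r - coupling p + coupling (p - q)})"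
    by (intro set_eqI) (simp add: rep_set_iff split_beta)
  also have "closed \<dots>"
    by (auto intro!: closed_INT closed_Collect_le continuous_intros)
  finally show ?thesis .
qed

text \<open>Relatedness makes the coupling term of \<open>exists_near_rep_set\<close> nonnegative,
  so the norm term alone is small and \<open>z\<close> is a limit of points of the closed touching
  set.\<close>

lemma rep_set_maximal:
  assumes rel: "\<And>q. q \<in> rep_set E \<Longrightarrow> 0 \<le> coupling (q - z)"
  shows "z \<in> rep_set E"
proof -
  have "z \<in> closure (rep_set E)"
    unfolding closure_approachable
  proof (intro allI impI)
    fix e :: real assume "0 < e"
    then have "0 < e\<^sup>2 / 2" by simp
    then obtain q where q: "q \<in> rep_set E" "coupling (q - z) + (norm (q - z))\<^sup>2 / 2 < e\<^sup>2 / 2"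
      by (rule exists_near_rep_set)
    then have "(norm (q - z))\<^sup>2 < e\<^sup>2" using rel[OF q(1)] by simp
    then have "norm (q - z) < e" using \<open>0 < e\<close> by (simp add: power_less_imp_less_base)
    then show "\<exists>q\<in>rep_set E. dist q z < e" using q(1) by (auto simp: dist_norm)
  qed
  then show ?thesis using closed_rep_set by (simp add: closure_closed)
qed

text \<open>With \<open>z\<close> chosen such that \<open>u\<close> nearly attains its norm at \<open>v - snd z\<close>, a point of the
  representative set near \<open>z\<close> in the sense of \<open>exists_near_rep_set\<close> does the job.\<close>

lemma negative_infimum:
  assumes "0 < \<delta>"
  obtains q where "q \<in> rep_set E" "blinfun_apply (canon (fst q) - u) (snd q - v) < \<delta>"
proof -
  obtain w where w: "norm w \<le> norm u" "blinfun_apply u w \<le> - (norm u)\<^sup>2 + \<delta> / 2"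
    using blinfun_near_dual[of "\<delta> / 2"] assms by auto
  have "0 < \<delta> / 2" using assms by simp
  then obtain q where q: "q \<in> rep_set E"
    and near: "coupling (q - (0, v - w)) + (norm (q - (0, v - w)))\<^sup>2 / 2 < \<delta> / 2"
    by (rule exists_near_rep_set)
  obtain x y where xy: "fst q = x" "snd q = v - w + y"
    by (metis add_diff_cancel_left' diff_add_cancel add.commute)
  have q_eq: "q - (0, v - w) = (x, y)"
    using xy by (cases q) simp
  have "blinfun_apply (canon (fst q) - u) (snd q - v) = blinfun_apply y x - blinfun_apply w x - blinfun_apply u y + blinfun_apply u w"
    by (simp add: xy blinfun.bilinear_simps)
  moreover have "- blinfun_apply w x \<le> norm u * norm x"
    using norm_blinfun[of w x] mult_right_mono[OF w(1), of "norm x"] by simp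
  moreover have "- blinfun_apply u y \<le> norm u * norm y"
    using norm_blinfun[of u y] by simp
  ultimately have *: "blinfun_apply (canon (fst q) - u) (snd q - v)
      \<le> blinfun_apply y x + norm u * norm x + norm u * norm y + blinfun_apply u w"
    by simp
  have near': "blinfun_apply y x + ((norm x)\<^sup>2 + (norm y)\<^sup>2) / 2 < \<delta> / 2"
    using near by (simp add: q_eq coupling_def norm_prod_power2)
  have "norm u * norm x \<le> ((norm u)\<^sup>2 + (norm x)\<^sup>2) / 2" "norm u * norm y \<le> ((norm u)\<^sup>2 + (norm y)\<^sup>2) / 2"
    using sum_squares_bound[of "norm u" "norm x"] sum_squares_bound[of "norm u" "norm y"] by simp_all
  then have "blinfun_apply (canon (fst q) - u) (snd q - v) < \<delta>"
    using * near' w(2) by argo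
  with q show thesis by (rule that)
qed

text \<open>The conjugate is convex, lies above the pairing and touches it at
  \<open>(v\<^sub>0, u\<^sub>0)\<close>, so it lies above the tangent of the pairing there.
  Equivalently, the biconjugate at that point is at most \<open>u\<^sub>0 v\<^sub>0\<close>.\<close>

lemma affine_minorant_of_biconjugate:
  assumes 0: "\<And>p r. (p, r) \<in> E \<Longrightarrow> blinfun_apply v\<^sub>0 (fst p) + blinfun_apply u\<^sub>0 (snd p) - r \<le> blinfun_apply u\<^sub>0 v\<^sub>0"
    and 1: "\<And>p r. (p, r) \<in> E \<Longrightarrow> blinfun_apply v (fst p) + blinfun_apply u (snd p) - r \<le> s"
  shows "blinfun_apply u v\<^sub>0 + blinfun_apply u\<^sub>0 v - blinfun_apply u\<^sub>0 v\<^sub>0 \<le> s"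
proof -
  let ?a = "s - (blinfun_apply u v\<^sub>0 + blinfun_apply u\<^sub>0 v - blinfun_apply u\<^sub>0 v\<^sub>0)"
  let ?b = "blinfun_apply u v\<^sub>0 + blinfun_apply u\<^sub>0 v - blinfun_apply u\<^sub>0 v\<^sub>0 - blinfun_apply u v"
  have "0 \<le> ?a + t * ?b + t\<^sup>2 * 0" if t: "0 < t" "t < 1" for t
  proof -
    have "blinfun_apply ((1 - t) *\<^sub>R u\<^sub>0 + t *\<^sub>R u) ((1 - t) *\<^sub>R v\<^sub>0 + t *\<^sub>R v) \<le> (1 - t) * blinfun_apply u\<^sub>0 v\<^sub>0 + t * s"
    proof (rule conj_ge)
      fix p r assume p: "(p, r) \<in> E"
      have "(1 - t) * (blinfun_apply v\<^sub>0 (fst p) + blinfun_apply u\<^sub>0 (snd p) - r) \<le> (1 - t) * blinfun_apply u\<^sub>0 v\<^sub>0"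
        using 0[OF p] t by (intro mult_left_mono) auto
      moreover have "t * (blinfun_apply v (fst p) + blinfun_apply u (snd p) - r) \<le> t * s"
        using 1[OF p] t by (intro mult_left_mono) auto
      ultimately show "blinfun_apply ((1 - t) *\<^sub>R v\<^sub>0 + t *\<^sub>R v) (fst p)
          + blinfun_apply ((1 - t) *\<^sub>R u\<^sub>0 + t *\<^sub>R u) (snd p) - r \<le> (1 - t) * blinfun_apply u\<^sub>0 v\<^sub>0 + t * s"
        by (simp add: blinfun.bilinear_simps algebra_simps)
    qed
    then have "0 \<le> t * (?a + t * ?b)"
      by (simp add: blinfun.bilinear_simps algebra_simps)
    then have "0 \<le> ?a + t * ?b"
      using t by (simp only: zero_le_mult_iff) auto
    then show ?thesis by simp
  qed
  then have "0 \<le> ?a" by (rule nonneg_from_small_perturbation)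
  then show ?thesis by simp
qed

end

section \<open>Approximation of bidual points by a convex penalty\<close>

lemma convex_on_UNIV_norm_affine:
  fixes f :: "'v::real_vector \<Rightarrow> 'w::real_normed_vector"
  assumes "linear f"
  shows "convex_on UNIV (\<lambda>x. norm (f x - k))"
  unfolding convex_on_def
proof (intro conjI ballI allI impI)
  fix x y and a b :: real assume ab: "0 \<le> a" "0 \<le> b" "a + b = 1"
  interpret linear f by fact
  have "f (a *\<^sub>R x + b *\<^sub>R y) - k = a *\<^sub>R f x + b *\<^sub>R f y - (a + b) *\<^sub>R k"
    using ab(3) by (simp add: add scaleR)
  also have "\<dots> = a *\<^sub>R (f x - k) + b *\<^sub>R (f y - k)"
    by (simp add: scaleR_add_left scaleR_diff_right)
  also have "norm \<dots> \<le> a * norm (f x - k) + b * norm (f y - k)"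
    using norm_triangle_ineq[of "a *\<^sub>R (f x - k)" "b *\<^sub>R (f y - k)"] ab by simp
  finally show "norm (f (a *\<^sub>R x + b *\<^sub>R y) - k) \<le> a * norm (f x - k) + b * norm (f y - k)" .
qed simp

lemma convex_on_UNIV_max0:
  assumes "convex_on UNIV f"
  shows "convex_on UNIV (\<lambda>x. max 0 (f x - k))"
  unfolding convex_on_def
proof (intro conjI ballI allI impI)
  fix x y and a b :: real assume ab: "0 \<le> a" "0 \<le> b" "a + b = 1"
  have "f (a *\<^sub>R x + b *\<^sub>R y) - k \<le> a * f x + b * f y - (a + b) * k"
    using convex_on_UNIV_comb[OF assms ab] ab(3) by simp
  also have "\<dots> = a * (f x - k) + b * (f y - k)" by (simp add: algebra_simps)
  also have "\<dots> \<le> a * max 0 (f x - k) + b * max 0 (f y - k)"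
    using ab by (intro add_mono mult_left_mono) auto
  finally show "max 0 (f (a *\<^sub>R x + b *\<^sub>R y) - k) \<le> a * max 0 (f x - k) + b * max 0 (f y - k)"
    using ab by (simp add: add_nonneg_nonneg)
qed simp

lemma convex_on_UNIV_sum:
  assumes "\<And>i. i \<in> I \<Longrightarrow> convex_on UNIV (f i)"
  shows "convex_on UNIV (\<lambda>x. \<Sum>i\<in>I. f i x)"
  using assms
proof (induction I rule: infinite_finite_induct)
  case (insert i I)
  then have "convex_on UNIV (\<lambda>x. f i x + (\<Sum>i\<in>I. f i x))"
    by (intro convex_on_add) auto
  with insert(1,2) show ?case by simp
qed (simp_all add: convex_on_def)

text \<open>The three terms penalize weak-star distance tested on \<open>J\<close>, norm distance in
  the dual, and excess norm; the last one keeps the net bounded. The form \<open>fst p - 0\<close>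
  matches \<open>convex_on_UNIV_norm_affine\<close>.\<close>

definition residual :: "('x::real_normed_vector \<Rightarrow>\<^sub>L real) set \<Rightarrow> (('x \<Rightarrow>\<^sub>L real) \<Rightarrow>\<^sub>L real) \<Rightarrow> ('x \<Rightarrow>\<^sub>L real)
    \<Rightarrow> 'x \<times> ('x \<Rightarrow>\<^sub>L real) \<Rightarrow> real" where
  "residual J u v p = (\<Sum>f\<in>J. norm (blinfun_apply f (fst p) - blinfun_apply u f)) + norm (snd p - v)
    + max 0 (norm (fst p - 0) - norm u)"

lemma residual_nonneg: "0 \<le> residual J u v p"
  by (simp add: residual_def sum_nonneg)

lemma norm_fst_le_residual: "norm (fst p) \<le> norm u + residual J u v p"
  and norm_snd_le_residual: "norm (snd p - v) \<le> residual J u v p"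
proof -
  have "0 \<le> (\<Sum>f\<in>J. norm (blinfun_apply f (fst p) - blinfun_apply u f))"
    by (rule sum_nonneg) simp
  then show "norm (fst p) \<le> norm u + residual J u v p" "norm (snd p - v) \<le> residual J u v p"
    using norm_ge_zero[of "snd p - v"] unfolding residual_def diff_zero by linarith+
qed

lemma apply_le_residual:
  assumes "finite J" "f \<in> J"
  shows "\<bar>blinfun_apply f (fst p) - blinfun_apply u f\<bar> \<le> residual J u v p"
proof -
  have "norm (blinfun_apply f (fst p) - blinfun_apply u f)
      \<le> (\<Sum>f\<in>J. norm (blinfun_apply f (fst p) - blinfun_apply u f))"
    using assms by (intro member_le_sum) auto
  then show ?thesis
    using norm_ge_zero[of "snd p - v"] unfolding residual_def real_norm_def by linarith
qed

lemma convex_on_residual: "convex_on UNIV (residual J u v)"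
  unfolding residual_def
  by (intro convex_on_add convex_on_UNIV_sum convex_on_UNIV_max0 convex_on_UNIV_norm_affine)
    (auto intro!: bounded_linear.linear bounded_linear_compose[OF blinfun.bounded_linear_right]
      bounded_linear_fst bounded_linear_snd)

lemma continuous_on_residual: "continuous_on UNIV (residual J u v)"
  unfolding residual_def by (intro continuous_intros)

context strong_epigraph
begin

text \<open>A failure would produce an affine minorant of \<open>E\<close> whose value at
  \<open>(u\<^sub>0, v\<^sub>0)\<close> exceeds what \<open>affine_minorant_of_biconjugate\<close>
  permits. The bidual point cannot be inserted into the penalty, so Goldstine's theorem replaces
  \<open>u\<^sub>0\<close> by some \<open>x\<close>.\<close>

lemma approximate_penalized:
  assumes le: "\<And>p r. (p, r) \<in> E \<Longrightarrow> blinfun_apply v\<^sub>0 (fst p) + blinfun_apply u\<^sub>0 (snd p) - r \<le> blinfun_apply u\<^sub>0 v\<^sub>0"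
    and J: "finite J" and N: "0 \<le> N" and \<eta>: "0 < \<eta>"
  obtains p r where "(p, r) \<in> E" "r + N * residual J u\<^sub>0 v\<^sub>0 p < blinfun_apply u\<^sub>0 v\<^sub>0 + \<eta>"
proof (rule ccontr)
  assume none: "\<not> thesis"
  define P where "P p = N * residual J u\<^sub>0 v\<^sub>0 p + (- blinfun_apply u\<^sub>0 v\<^sub>0 - \<eta>)" for p
  have nonneg: "0 \<le> r + P p" if "(p, r) \<in> E" for p r
    using none that \<open>\<And>p r. (p, r) \<in> E \<Longrightarrow> _ \<Longrightarrow> thesis\<close>[of p r] by (force simp: P_def not_less)
  have cvx: "convex_on UNIV P"
    unfolding P_def by (intro convex_on_add convex_on_cmul N convex_on_residual) (simp add: convex_on_const)
  have cont: "continuous_on UNIV P"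
    unfolding P_def by (intro continuous_intros continuous_on_residual)
  obtain l \<sigma> where l: "\<And>q r. (q, r) \<in> E \<Longrightarrow> blinfun_apply l q - \<sigma> \<le> r"
    and lP: "\<And>q. 0 \<le> blinfun_apply l q - \<sigma> + P q"
    using convex_sandwich[OF convex_E E_nonempty cvx cont nonneg] by blast
  obtain v u where vu: "\<And>x y. l (x, y) = blinfun_apply v x + blinfun_apply u y"
    using blinfun_prod_split by blast
  have \<sigma>: "blinfun_apply u v\<^sub>0 + blinfun_apply u\<^sub>0 v - blinfun_apply u\<^sub>0 v\<^sub>0 \<le> \<sigma>"
    using l vu by (intro affine_minorant_of_biconjugate[OF le]) force+
  \<comment> \<open>Each element of \<open>J\<close> costs \<open>N * \<kappa>\<close> and the
    functional \<open>v\<close> costs \<open>\<kappa>\<close>; the factor 2 makes the bound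
    strict.\<close>
  define \<kappa> where "\<kappa> = \<eta> / (2 * (N * card J + 1))"
  have "0 < N * card J + 1" using N by (simp add: add_nonneg_pos)
  then have \<kappa>: "0 < \<kappa>" "(N * card J + 1) * \<kappa> < \<eta>"
  proof -
    have "k * (\<eta> / (2 * k)) = \<eta> / 2" if "0 < k" for k using that by simp
    then show "0 < \<kappa>" "(N * card J + 1) * \<kappa> < \<eta>"
      unfolding \<kappa>_def using \<eta> \<open>0 < N * card J + 1\<close> by (simp, simp only:)
  qed
  obtain x where x: "norm x \<le> norm u\<^sub>0"
    and gold: "(\<Sum>f\<in>insert v J. (u\<^sub>0 f - blinfun_apply f x)\<^sup>2) < \<kappa>\<^sup>2"
    using goldstine[of "insert v J" "\<kappa>\<^sup>2"] J \<kappa>(1) by auto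
  have close: "\<bar>blinfun_apply f x - u\<^sub>0 f\<bar> \<le> \<kappa>" if "f \<in> insert v J" for f
  proof -
    have "(u\<^sub>0 f - blinfun_apply f x)\<^sup>2 \<le> (\<Sum>f\<in>insert v J. (u\<^sub>0 f - blinfun_apply f x)\<^sup>2)"
      using that J by (intro member_le_sum) auto
    then have "(blinfun_apply f x - u\<^sub>0 f)\<^sup>2 \<le> \<kappa>\<^sup>2"
      using gold by (simp add: power2_commute)
    then show ?thesis using \<kappa>(1) by (simp add: abs_le_square_iff[symmetric])
  qed
  have "(\<Sum>f\<in>J. norm (blinfun_apply f x - blinfun_apply u\<^sub>0 f)) \<le> card J * \<kappa>"
    using close by (intro sum_bounded_above) auto
  then have "N * residual J u\<^sub>0 v\<^sub>0 (x, v\<^sub>0) \<le> N * (card J * \<kappa>)"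
    using N x by (intro mult_left_mono) (auto simp: residual_def)
  moreover have "0 \<le> l (x, v\<^sub>0) - \<sigma> + P (x, v\<^sub>0)" by (rule lP)
  moreover have "blinfun_apply v x \<le> u\<^sub>0 v + \<kappa>" using close[of v] by (simp add: abs_le_iff)
  ultimately show False
    using \<sigma> \<kappa>(2) by (simp add: vu P_def algebra_simps)
qed

text \<open>By \<open>le\<close>, \<open>r\<close> is bounded below by a function of the residual
  \<open>R\<close> that falls at most with slope \<open>norm u\<^sub>0 + norm v\<^sub>0\<close>. The
  weight \<open>N\<close> exceeds this slope by \<open>K / \<eta>\<close>, which forces
  \<open>R < \<eta>\<close>.\<close>

lemma approximate_in_E:
  assumes le: "\<And>p r. (p, r) \<in> E \<Longrightarrow> blinfun_apply v\<^sub>0 (fst p) + blinfun_apply u\<^sub>0 (snd p) - r \<le> blinfun_apply u\<^sub>0 v\<^sub>0"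
    and J: "finite J" and \<eta>: "0 < \<eta>"
  obtains p r where "(p, r) \<in> E" "r < blinfun_apply u\<^sub>0 v\<^sub>0 + \<eta>" "residual J u\<^sub>0 v\<^sub>0 p < \<eta>"
proof -
  let ?\<alpha> = "blinfun_apply u\<^sub>0 v\<^sub>0"
  define K where "K = 2 * \<bar>?\<alpha>\<bar> + \<eta> + 2 * (norm u\<^sub>0 * norm v\<^sub>0)"
  define N where "N = norm u\<^sub>0 + norm v\<^sub>0 + K / \<eta>"
  have K: "0 < K" using \<eta> by (simp add: K_def add_nonneg_pos add_pos_nonneg)
  then have "0 \<le> N" using \<eta> by (simp add: N_def)
  then obtain p r where p: "(p, r) \<in> E" and r: "r + N * residual J u\<^sub>0 v\<^sub>0 p < ?\<alpha> + \<eta>"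
    using approximate_penalized[OF le J _ \<eta>] by blast
  define R where "R = residual J u\<^sub>0 v\<^sub>0 p"
  have R: "0 \<le> R" by (simp add: R_def residual_nonneg)
  have "- blinfun_apply v\<^sub>0 (fst p) \<le> norm v\<^sub>0 * norm (fst p)"
    using norm_blinfun[of v\<^sub>0 "fst p"] by simp
  also have "\<dots> \<le> norm v\<^sub>0 * (norm u\<^sub>0 + R)"
    by (intro mult_left_mono) (auto simp: R_def norm_fst_le_residual)
  finally have 1: "- blinfun_apply v\<^sub>0 (fst p) \<le> norm v\<^sub>0 * (norm u\<^sub>0 + R)" .
  have "norm (snd p) \<le> norm v\<^sub>0 + R"
    using norm_snd_le_residual[of p v\<^sub>0 J u\<^sub>0] norm_triangle_ineq2[of "snd p" v\<^sub>0] by (simp add: R_def)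
  then have "norm u\<^sub>0 * norm (snd p) \<le> norm u\<^sub>0 * (norm v\<^sub>0 + R)"
    by (intro mult_left_mono) auto
  moreover have "- blinfun_apply u\<^sub>0 (snd p) \<le> norm u\<^sub>0 * norm (snd p)"
    using norm_blinfun[of u\<^sub>0 "snd p"] by simp
  ultimately have 2: "- blinfun_apply u\<^sub>0 (snd p) \<le> norm u\<^sub>0 * (norm v\<^sub>0 + R)" by linarith
  have "N * R < 2 * \<bar>?\<alpha>\<bar> + \<eta> + norm v\<^sub>0 * (norm u\<^sub>0 + R) + norm u\<^sub>0 * (norm v\<^sub>0 + R)"
    using r le[OF p] 1 2 unfolding R_def[symmetric] by linarith
  then have "(K / \<eta>) * R < K"
    by (simp add: N_def K_def algebra_simps)
  then have "R < \<eta>" using K \<eta> by (simp add: field_simps)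
  moreover have "0 \<le> N * R" using \<open>0 \<le> N\<close> R by simp
  then have "r < ?\<alpha> + \<eta>" using r by (simp add: R_def)
  ultimately show thesis using that[OF p] by (simp add: R_def)
qed

text \<open>Adding \<open>v\<^sub>0\<close> to the tested functionals makes
  \<open>coupling p\<close> close to \<open>u\<^sub>0 v\<^sub>0\<close>, hence the gap of
  \<open>(p, r)\<close> small, and \<open>broendsted_rockafellar\<close> applies.\<close>

lemma approximate_in_rep_set:
  assumes le: "\<And>p r. (p, r) \<in> E \<Longrightarrow> blinfun_apply v\<^sub>0 (fst p) + blinfun_apply u\<^sub>0 (snd p) - r \<le> blinfun_apply u\<^sub>0 v\<^sub>0"
    and J: "finite J" and \<theta>: "0 < \<theta>" "\<theta> \<le> 1"
  obtains q where "q \<in> rep_set E" "\<And>f. f \<in> J \<Longrightarrow> \<bar>blinfun_apply f (fst q) - blinfun_apply u\<^sub>0 f\<bar> < \<theta>"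
    "norm (snd q - v\<^sub>0) < \<theta>" "norm (fst q) \<le> norm u\<^sub>0 + 1"
proof -
  let ?\<alpha> = "blinfun_apply u\<^sub>0 v\<^sub>0"
  \<comment> \<open>Moving by \<open>6 * s\<close> changes \<open>f\<close> by at most
    \<open>6 * s * norm f\<close>; the 7 covers \<open>6 * s\<close> in the norm estimates plus
    \<open>\<eta> \<le> s\<close>.\<close>
  define C where "C = 7 + 6 * (\<Sum>f\<in>J. norm f)"
  define s where "s = \<theta> / (2 * C)"
  \<comment> \<open>The gap collects \<open>\<eta>\<close> from \<open>r\<close>,
    \<open>\<eta>\<close> from testing \<open>v\<^sub>0\<close>, and
    \<open>\<eta> * (norm u\<^sub>0 + 1)\<close> from the dual component.\<close>
  define \<eta> where "\<eta> = s\<^sup>2 / (3 + norm u\<^sub>0)"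
  have C: "7 \<le> C" by (simp add: C_def sum_nonneg)
  have s: "0 < s" "C * s < \<theta>" using C \<theta> by (auto simp: s_def field_simps)
  have "7 * s \<le> C * s" using C s by (intro mult_right_mono) auto
  then have s1: "7 * s < \<theta>" "s \<le> 1" using s \<theta> by linarith+
  have B: "0 < 3 + norm u\<^sub>0" by (simp add: add_pos_nonneg)
  have \<eta>: "0 < \<eta>" "\<eta> * (3 + norm u\<^sub>0) = s\<^sup>2" using s B by (auto simp: \<eta>_def)
  have "\<eta> * 1 \<le> \<eta> * (3 + norm u\<^sub>0)" using \<eta>(1) by (intro mult_left_mono) auto
  also have "\<dots> \<le> s" using s s1 \<eta>(2) by (simp add: power2_eq_square mult_le_cancel_left1)
  finally have \<eta>s: "\<eta> \<le> s" by simp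
  obtain p r where p: "(p, r) \<in> E" and r: "r < ?\<alpha> + \<eta>" and R: "residual (insert v\<^sub>0 J) u\<^sub>0 v\<^sub>0 p < \<eta>"
    using approximate_in_E[OF le _ \<eta>(1), of "insert v\<^sub>0 J"] J by auto
  have fp: "\<bar>blinfun_apply f (fst p) - blinfun_apply u\<^sub>0 f\<bar> < \<eta>" if "f \<in> insert v\<^sub>0 J" for f
    using apply_le_residual[of "insert v\<^sub>0 J" f p u\<^sub>0 v\<^sub>0] that J R by auto
  have sp: "norm (snd p - v\<^sub>0) < \<eta>" and np: "norm (fst p) \<le> norm u\<^sub>0 + \<eta>"
    using norm_snd_le_residual[of p v\<^sub>0 "insert v\<^sub>0 J" u\<^sub>0] norm_fst_le_residual[of p u\<^sub>0 "insert v\<^sub>0 J" v\<^sub>0] R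
    by auto
  have "\<bar>blinfun_apply (snd p - v\<^sub>0) (fst p)\<bar> \<le> norm (snd p - v\<^sub>0) * norm (fst p)"
    using norm_blinfun[of "snd p - v\<^sub>0" "fst p"] by simp
  also have "\<dots> \<le> \<eta> * (norm u\<^sub>0 + 1)"
    using sp np \<eta>s s1 \<eta>(1) by (intro mult_mono) auto
  finally have "?\<alpha> - \<eta> - \<eta> * (norm u\<^sub>0 + 1) \<le> coupling p"
    using fp[of v\<^sub>0] by (simp add: coupling_def blinfun.diff_left abs_le_iff abs_less_iff)
  then have "r \<le> coupling p + \<eta> * (3 + norm u\<^sub>0)"
    using r by (simp add: algebra_simps)
  then obtain q where q: "q \<in> rep_set E" "norm (q - p) \<le> 6 * sqrt (s\<^sup>2)"
    unfolding \<eta>(2) using broendsted_rockafellar[OF p, of "s\<^sup>2"] s(1) by auto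
  then have qp: "norm (q - p) \<le> 6 * s" using s by simp
  have qf: "norm (fst q - fst p) \<le> 6 * s" and qs: "norm (snd q - snd p) \<le> 6 * s"
    using qp dist_fst_le[of q p] dist_snd_le[of q p] by (auto simp: dist_norm)
  show thesis
  proof (rule that[OF q(1)])
    fix f assume f: "f \<in> J"
    have "\<bar>blinfun_apply f (fst q - fst p)\<bar> \<le> norm f * norm (fst q - fst p)"
      using norm_blinfun[of f "fst q - fst p"] by simp
    also have "\<dots> \<le> (\<Sum>f\<in>J. norm f) * (6 * s)"
      using qf f J by (intro mult_mono member_le_sum) (auto intro: sum_nonneg)
    finally have "\<bar>blinfun_apply f (fst q) - blinfun_apply f (fst p)\<bar> \<le> (\<Sum>f\<in>J. norm f) * (6 * s)"
      by (simp add: blinfun.diff_right)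
    moreover have "(\<Sum>f\<in>J. norm f) * (6 * s) + 7 * s = C * s"
      by (simp add: C_def algebra_simps)
    ultimately show "\<bar>blinfun_apply f (fst q) - blinfun_apply u\<^sub>0 f\<bar> < \<theta>"
      using fp[of f] f \<eta>s s by (simp add: abs_le_iff abs_less_iff)
  next
    show "norm (snd q - v\<^sub>0) < \<theta>"
      using norm_triangle_ineq[of "snd q - snd p" "snd p - v\<^sub>0"] qs sp \<eta>s s1 by simp
    show "norm (fst q) \<le> norm u\<^sub>0 + 1"
      using norm_triangle_ineq[of "fst q - fst p" "fst p"] qf np \<eta>s s1 \<theta> by simp
  qed
qed

end

section \<open>The convex hull of the coupling and type (D)\<close>

text \<open>Its conjugate is the Fitzpatrick function of \<open>M\<close> on the dual times the
  bidual.\<close>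

definition coupling_hull :: "('x::real_normed_vector \<times> ('x \<Rightarrow>\<^sub>L real)) set \<Rightarrow> (('x \<times> ('x \<Rightarrow>\<^sub>L real)) \<times> real) set" where
  "coupling_hull M = convex hull ((\<lambda>q. (q, coupling q)) ` M)"

lemma coupling_hull_inc: "q \<in> M \<Longrightarrow> (q, coupling q) \<in> coupling_hull M"
  by (simp add: coupling_hull_def hull_inc)

lemma coupling_hull_bound:
  assumes M: "\<And>q. q \<in> M \<Longrightarrow> blinfun_apply v (fst q) + blinfun_apply u (snd q) - coupling q \<le> s"
    and p: "(p, r) \<in> coupling_hull M"
  shows "blinfun_apply v (fst p) + blinfun_apply u (snd p) - r \<le> s"
proof -
  let ?H = "{z. blinfun_apply v (fst (fst z)) + blinfun_apply u (snd (fst z)) - snd z \<le> s}"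
  have "convex ?H"
  proof (rule convexI)
    fix x y :: "('a \<times> ('a \<Rightarrow>\<^sub>L real)) \<times> real" and a b :: real
    assume x: "x \<in> ?H" and y: "y \<in> ?H" and ab: "0 \<le> a" "0 \<le> b" "a + b = 1"
    have "a * (blinfun_apply v (fst (fst x)) + blinfun_apply u (snd (fst x)) - snd x)
        + b * (blinfun_apply v (fst (fst y)) + blinfun_apply u (snd (fst y)) - snd y) \<le> a * s + b * s"
      using x y ab by (intro add_mono mult_left_mono) auto
    also have "a * s + b * s = s"
      using ab(3) by (metis distrib_right mult_1)
    finally show "a *\<^sub>R x + b *\<^sub>R y \<in> ?H"
      by (simp add: blinfun.bilinear_simps algebra_simps)
  qed
  then have "coupling_hull M \<subseteq> ?H"
    unfolding coupling_hull_def using M by (intro hull_minimal) auto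
  then show ?thesis using p by auto
qed

lemma eventually_finite_subsets_sequentially:
  assumes "finite J" "\<And>J' n. finite J' \<Longrightarrow> J \<subseteq> J' \<Longrightarrow> N \<le> n \<Longrightarrow> P (J', n)"
  shows "eventually P (finite_subsets_at_top UNIV \<times>\<^sub>F sequentially)"
  unfolding eventually_prod_filter
proof (intro exI conjI allI impI)
  show "\<forall>\<^sub>F J' in finite_subsets_at_top UNIV. finite J' \<and> J \<subseteq> J'"
    using assms(1) by (auto simp: eventually_finite_subsets_at_top)
  show "\<forall>\<^sub>F n in sequentially. N \<le> n" by (rule eventually_ge_at_top)
qed (use assms(2) in auto)

context strong_epigraph
begin

text \<open>Monotonicity of the touching set gives \<open>coupling_le\<close>, and
  \<open>negative_infimum\<close> is exactly \<open>conj_ge\<close>.\<close>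

lemma strong_epigraph_coupling_hull: "strong_epigraph (coupling_hull (rep_set E))"
proof
  show "convex (coupling_hull (rep_set E))"
    by (simp add: coupling_hull_def)
next
  fix p r assume p: "(p, r) \<in> coupling_hull (rep_set E)"
  \<comment> \<open>The half-space bound is used twice: here for \<open>p\<close> against each
    generator \<open>q\<close>, then with \<open>p\<close> also as the functional.\<close>
  have "blinfun_apply (snd q) (fst p) + blinfun_apply (snd p) (fst q) - r \<le> coupling q" if q: "q \<in> rep_set E" for q
    using coupling_hull_bound[OF _ p, where v = "snd q" and u = "canon (fst q)" and s = "coupling q"]
      rep_set_monotone[OF _ q] by (force simp: coupling_diff)
  then have "blinfun_apply (snd p) (fst p) + blinfun_apply (canon (fst p)) (snd p) - r \<le> r"
    by (intro coupling_hull_bound[OF _ p]) (force simp: algebra_simps)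
  then show "coupling p \<le> r" by (simp add: coupling_def)
next
  fix v u s
  assume bd: "\<And>p r. (p, r) \<in> coupling_hull (rep_set E) \<Longrightarrow>
    blinfun_apply v (fst p) + blinfun_apply u (snd p) - r \<le> s"
  show "blinfun_apply u v \<le> s"
  proof (rule field_le_epsilon)
    fix e :: real assume "0 < e"
    then obtain q where q: "q \<in> rep_set E" "blinfun_apply (canon (fst q) - u) (snd q - v) < e"
      by (rule negative_infimum)
    then show "blinfun_apply u v \<le> s + e"
      using bd[OF coupling_hull_inc[OF q(1)]] unfolding canon_diff_apply by linarith
  qed
qed

text \<open>Ensures that the approximants obtained from the hull are points of the original touching
  set.\<close>

lemma rep_set_coupling_hull: "rep_set (coupling_hull (rep_set E)) \<subseteq> rep_set E"
proof
  fix z assume "z \<in> rep_set (coupling_hull (rep_set E))"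
  then have "0 \<le> coupling (q - z)" if "q \<in> rep_set E" for q
    using coupling_hull_inc[OF that] by (force simp: rep_set_iff)
  then show "z \<in> rep_set E" by (rule rep_set_maximal)
qed

text \<open>For the hull, the hypothesis of \<open>approximate_in_rep_set\<close> is membership in
  the Gossez closure, read on generators (\<open>rel\<close>). The net is indexed by finite sets of
  functionals and precisions \<open>1 / Suc n\<close>.\<close>

theorem gossez_type_D_if_graph_eq:
  assumes S: "graph S = rep_set E"
  shows "gossez_type_D S"
  unfolding gossez_type_D_def
proof (intro conjI ballI)
  have pair: "coupling ((y, ys) - (z, zs)) = blinfun_apply (ys - zs) (y - z)" for y z :: 'x and ys zs
    by (simp add: coupling_def)
  show "maximal_monotone S"
    unfolding maximal_monotone_def
  proof (intro conjI allI impI)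
    show "monotone_op S"
      unfolding monotone_op_def S using rep_set_monotone pair by force
  next
    fix S' assume S': "monotone_op S' \<and> graph S \<subseteq> graph S'"
    have "z \<in> rep_set E" if z: "z \<in> graph S'" for z
    proof (rule rep_set_maximal)
      fix q assume "q \<in> rep_set E"
      then have "q \<in> graph S'" using S S' by auto
      then show "0 \<le> coupling (q - z)"
        using S' z pair[of "fst q" "snd q" "fst z" "snd z"] by (force simp: monotone_op_def)
    qed
    then show "graph S' = graph S" using S S' by auto
  qed
next
  fix z assume z: "z \<in> gossez_closure S"
  obtain u v where uv: "z = (u, v)" by (cases z)
  have hull: "strong_epigraph (coupling_hull (rep_set E))"
    by (rule strong_epigraph_coupling_hull)
  have rel: "blinfun_apply v (fst p) + blinfun_apply u (snd p) - r \<le> blinfun_apply u v"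
    if p: "(p, r) \<in> coupling_hull (rep_set E)" for p r
  proof (rule coupling_hull_bound[OF _ p])
    fix q assume "q \<in> rep_set E"
    then have "0 \<le> blinfun_apply (u - canon (fst q)) (v - snd q)"
      using z S by (force simp: gossez_closure_def uv)
    moreover have "blinfun_apply (u - canon (fst q)) (v - snd q) = blinfun_apply (canon (fst q) - u) (snd q - v)"
      by (simp add: blinfun.bilinear_simps)
    ultimately show "blinfun_apply v (fst q) + blinfun_apply u (snd q) - coupling q \<le> blinfun_apply u v"
      unfolding canon_diff_apply by linarith
  qed
  have "\<exists>q. q \<in> rep_set E \<and> (\<forall>f\<in>J. \<bar>blinfun_apply f (fst q) - blinfun_apply u f\<bar> < 1 / Suc n)
    \<and> norm (snd q - v) < 1 / Suc n \<and> norm (fst q) \<le> norm u + 1" if "finite J" for J n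
    using strong_epigraph.approximate_in_rep_set[OF hull rel that, of "1 / Suc n"] rep_set_coupling_hull
    by (metis subsetD divide_le_eq_1_pos of_nat_0_less_iff zero_less_Suc zero_less_divide_1_iff of_nat_1 of_nat_le_iff Suc_leI One_nat_def)
  then obtain g where g: "\<And>J n. finite J \<Longrightarrow> g (J, n) \<in> rep_set E"
    "\<And>J n f. finite J \<Longrightarrow> f \<in> J \<Longrightarrow> \<bar>blinfun_apply f (fst (g (J, n))) - blinfun_apply u f\<bar> < 1 / Suc n"
    "\<And>J n. finite J \<Longrightarrow> norm (snd (g (J, n)) - v) < 1 / Suc n"
    "\<And>J n. finite J \<Longrightarrow> norm (fst (g (J, n))) \<le> norm u + 1"
  proof -
    define g where "g = (\<lambda>(J, n). SOME q. q \<in> rep_set E \<and> (\<forall>f\<in>J. \<bar>blinfun_apply f (fst q) - blinfun_apply u f\<bar> < 1 / Suc n)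
      \<and> norm (snd q - v) < 1 / Suc n \<and> norm (fst q) \<le> norm u + 1)"
    assume ex: "\<And>J n. finite J \<Longrightarrow> \<exists>q. q \<in> rep_set E \<and> (\<forall>f\<in>J. \<bar>blinfun_apply f (fst q) - blinfun_apply u f\<bar> < 1 / Suc n)
      \<and> norm (snd q - v) < 1 / Suc n \<and> norm (fst q) \<le> norm u + 1"
    have "g (J, n) \<in> rep_set E \<and> (\<forall>f\<in>J. \<bar>blinfun_apply f (fst (g (J, n))) - blinfun_apply u f\<bar> < 1 / Suc n)
      \<and> norm (snd (g (J, n)) - v) < 1 / Suc n \<and> norm (fst (g (J, n))) \<le> norm u + 1" if "finite J" for J n
      unfolding g_def prod.case by (rule someI_ex[OF ex[OF that]])
    then show thesis by (intro that[of g]) blast+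
  qed
  define F where "F = filtermap g (finite_subsets_at_top UNIV \<times>\<^sub>F sequentially)"
  have inv: "\<exists>N. \<forall>n\<ge>N. 1 / real (Suc n) < e" if "0 < e" for e
  proof -
    obtain N where N: "1 / real (Suc N) < e"
      using nat_approx_posE[OF \<open>0 < e\<close>] by auto
    have "1 / real (Suc n) \<le> 1 / real (Suc N)" if "N \<le> n" for n
      using that by (simp add: frac_le)
    then show ?thesis using N by (meson order_le_less_trans)
  qed
  show "case z of (yss, ys) \<Rightarrow> \<exists>F. F \<noteq> bot \<and> (\<forall>\<^sub>F p in F. p \<in> graph S) \<and>
      (\<exists>B. \<forall>\<^sub>F p in F. norm (fst p) \<le> B \<and> norm (snd p) \<le> B) \<and>
      (\<forall>f. ((\<lambda>p. blinfun_apply f (fst p)) \<longlongrightarrow> blinfun_apply yss f) F) \<and> (snd \<longlongrightarrow> ys) F"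
    unfolding uv prod.case
  proof (intro exI[of _ F] conjI allI exI[of _ "norm u + norm v + 1"])
    show "F \<noteq> bot"
      by (simp add: F_def filtermap_bot_iff prod_filter_eq_bot)
    show "\<forall>\<^sub>F p in F. p \<in> graph S"
      unfolding F_def eventually_filtermap S
      by (rule eventually_finite_subsets_sequentially[of "{}" 0]) (auto simp: g)
    show "\<forall>\<^sub>F p in F. norm (fst p) \<le> norm u + norm v + 1 \<and> norm (snd p) \<le> norm u + norm v + 1"
      unfolding F_def eventually_filtermap
    proof (rule eventually_finite_subsets_sequentially[of "{}" 0])
      fix J :: "('x \<Rightarrow>\<^sub>L real) set" and n :: nat assume J: "finite J"
      have "norm (snd (g (J, n))) \<le> norm v + 1 / real (Suc n)"
        using g(3)[OF J, of n] norm_triangle_ineq2[of "snd (g (J, n))" v] by linarith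
      moreover have "1 / real (Suc n) \<le> 1" by simp
      ultimately have "norm (snd (g (J, n))) \<le> norm u + norm v + 1"
        using norm_ge_zero[of u] by linarith
      then show "norm (fst (g (J, n))) \<le> norm u + norm v + 1 \<and> norm (snd (g (J, n))) \<le> norm u + norm v + 1"
        using g(4)[OF J, of n] norm_ge_zero[of v] by (auto intro: order_trans)
    qed simp
    show "((\<lambda>p. blinfun_apply f (fst p)) \<longlongrightarrow> blinfun_apply u f) F" for f
    proof (rule tendstoI)
      fix e :: real assume "0 < e"
      then obtain N where N: "\<And>n. N \<le> n \<Longrightarrow> 1 / real (Suc n) < e" using inv by blast
      show "\<forall>\<^sub>F p in F. dist (blinfun_apply f (fst p)) (blinfun_apply u f) < e"
        unfolding F_def eventually_filtermap dist_real_def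
        by (rule eventually_finite_subsets_sequentially[of "{f}" N]) (use g(2) N in \<open>force intro: less_trans\<close>)+
    qed
    show "(snd \<longlongrightarrow> v) F"
    proof (rule tendstoI)
      fix e :: real assume "0 < e"
      then obtain N where N: "\<And>n. N \<le> n \<Longrightarrow> 1 / real (Suc n) < e" using inv by blast
      show "\<forall>\<^sub>F p in F. dist (snd p) v < e"
        unfolding F_def eventually_filtermap dist_norm
        by (rule eventually_finite_subsets_sequentially[of "{}" N]) (use g(3) N in \<open>force intro: less_trans\<close>)+
    qed
  qed
qed

end

section \<open>An open mapping theorem for closed convex bounded sets\<close>

lemma affine_hull_setdiff:
  assumes "a \<in> D"
  shows "affine hull (setdiff D D) = (\<lambda>x. x - a) ` (affine hull D)"
proof
  have sub: "subspace ((\<lambda>x. x - a) ` (affine hull D))"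
    using assms by (intro affine_diffs_subspace_subtract affine_affine_hull hull_inc)
  have "s - t \<in> (\<lambda>x. x - a) ` (affine hull D)" if "s \<in> D" "t \<in> D" for s t
  proof -
    have "(s - a) - (t - a) \<in> (\<lambda>x. x - a) ` (affine hull D)"
      using that by (intro subspace_diff[OF sub] imageI hull_inc)
    then show ?thesis by simp
  qed
  then have "setdiff D D \<subseteq> (\<lambda>x. x - a) ` (affine hull D)"
    unfolding setdiff_def by blast
  then show "affine hull (setdiff D D) \<subseteq> (\<lambda>x. x - a) ` (affine hull D)"
    using sub by (intro hull_minimal subspace_imp_affine)
  have "(\<lambda>x. - a + x) ` (affine hull D) = affine hull ((\<lambda>x. - a + x) ` D)"
    by (rule affine_hull_translation[symmetric])
  also have "\<dots> \<subseteq> affine hull (setdiff D D)"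
    using assms by (intro hull_mono) (auto simp: setdiff_def)
  finally show "(\<lambda>x. x - a) ` (affine hull D) \<subseteq> affine hull (setdiff D D)" by simp
qed

lemma subspace_affine_hull_setdiff:
  assumes "D \<noteq> {}"
  shows "subspace (affine hull (setdiff D D))"
proof -
  obtain a where "a \<in> D" using assms by blast
  then show ?thesis
    by (simp add: affine_hull_setdiff affine_diffs_subspace_subtract hull_inc)
qed

lemma closed_affine_hull_setdiff:
  fixes D :: "'v::real_normed_vector set"
  assumes "D \<noteq> {}" "closed (affine hull D)"
  shows "closed (affine hull (setdiff D D))"
proof -
  obtain a where "a \<in> D" using assms by blast
  then show ?thesis
    using closed_translation[OF assms(2), of "- a"] by (simp add: affine_hull_setdiff)
qed

text \<open>Successive approximation as in the open mapping theorem; closedness, convexity and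
  boundedness of \<open>C\<close> keep the dyadic combination of the approximants in \<open>C\<close>.\<close>

lemma ball_in_image_if_in_closure:
  fixes f :: "'z::banach \<Rightarrow> 'y::real_normed_vector"
  assumes f: "bounded_linear f" and C: "closed C" "convex C" "bounded C" and V: "subspace V"
    and ball: "\<And>v. v \<in> V \<Longrightarrow> norm v < e \<Longrightarrow> v \<in> closure {v\<in>V. u + v \<in> f ` C}"
    and v: "v \<in> V" "norm v < e / 2"
  shows "u + v \<in> f ` C"
proof -
  interpret f: bounded_linear f by fact
  have "0 < e" using v(2) norm_ge_zero[of v] by linarith
  have "\<exists>z\<in>C. f z - u \<in> V \<and> norm (r - (f z - u)) < e / 2" if r: "r \<in> V" "norm r < e" for r
  proof -
    have "\<exists>d\<in>{v\<in>V. u + v \<in> f ` C}. dist d r < e / 2"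
      using ball[OF r] \<open>0 < e\<close> unfolding closure_approachable by (meson half_gt_zero)
    then obtain d where d: "d \<in> V" "u + d \<in> f ` C" "dist d r < e / 2"
      by blast
    then obtain z where "z \<in> C" "f z = u + d" by auto
    with d show ?thesis by (intro bexI[of _ z]) (auto simp: dist_norm norm_minus_commute)
  qed
  then obtain \<zeta> where \<zeta>: "\<And>r. r \<in> V \<Longrightarrow> norm r < e \<Longrightarrow> \<zeta> r \<in> C \<and> f (\<zeta> r) - u \<in> V \<and> norm (r - (f (\<zeta> r) - u)) < e / 2"
    by metis
  \<comment> \<open>\<open>r n\<close> is the remaining error magnified by powers of 2, so it stays
    in the ball of radius \<open>e\<close>. The start is \<open>2 *\<^sub>R v\<close> because the
    first approximant has weight 1/2.\<close>
  define r where "r = rec_nat (2 *\<^sub>R v) (\<lambda>_ r. 2 *\<^sub>R (r - (f (\<zeta> r) - u)))"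
  have r0: "r 0 = 2 *\<^sub>R v" and rS: "r (Suc n) = 2 *\<^sub>R (r n - (f (\<zeta> (r n)) - u))" for n
    by (simp_all add: r_def)
  have r: "r n \<in> V \<and> norm (r n) < e" for n
  proof (induction n)
    case 0
    then show ?case using v V by (simp add: r0 subspace_scale)
  next
    case (Suc n)
    then show ?case using \<zeta>[of "r n"] V by (simp add: rS subspace_scale subspace_diff)
  qed
  define \<sigma> where "\<sigma> n = (\<Sum>i<n. (1/2)^Suc i *\<^sub>R \<zeta> (r i))" for n
  \<comment> \<open>The weights used so far sum to 1 minus \<open>(1/2)^n\<close>; any point
    \<open>c\<close> of \<open>C\<close> takes the rest.\<close>
  have in_C: "c \<in> C \<Longrightarrow> \<sigma> n + (1/2)^n *\<^sub>R c \<in> C" for n c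
  proof (induction n arbitrary: c)
    case 0
    then show ?case by (simp add: \<sigma>_def)
  next
    case (Suc n)
    have "(1/2) *\<^sub>R \<zeta> (r n) + (1/2) *\<^sub>R c \<in> C"
      using \<zeta> r Suc.prems by (intro convexD[OF C(2)]) auto
    then have "\<sigma> n + (1/2)^n *\<^sub>R ((1/2) *\<^sub>R \<zeta> (r n) + (1/2) *\<^sub>R c) \<in> C"
      by (rule Suc.IH)
    then show ?case by (simp add: \<sigma>_def algebra_simps)
  qed
  have f\<sigma>: "f (\<sigma> n) = u + v - (1/2)^n *\<^sub>R (u + (1/2) *\<^sub>R r n)" for n
  proof (induction n)
    case 0
    then show ?case by (simp add: \<sigma>_def r0 f.zero)
  next
    case (Suc n)
    have "f (\<sigma> (Suc n)) = f (\<sigma> n) + (1/2)^n *\<^sub>R ((1/2) *\<^sub>R f (\<zeta> (r n)))"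
      by (simp add: \<sigma>_def f.add f.scaleR)
    moreover have "(1/2)^Suc n *\<^sub>R (u + (1/2) *\<^sub>R r (Suc n)) = (1/2)^n *\<^sub>R (u + (1/2) *\<^sub>R r n - (1/2) *\<^sub>R f (\<zeta> (r n)))"
    proof -
      have "(1/2) *\<^sub>R (u + (1/2) *\<^sub>R r (Suc n)) = u + (1/2) *\<^sub>R r n - (1/2) *\<^sub>R f (\<zeta> (r n))"
      proof -
        have "u = (1/2) *\<^sub>R u + (1/2) *\<^sub>R u"
          by (simp flip: scaleR_add_left)
        then show ?thesis by (simp add: rS algebra_simps)
      qed
      moreover have "(1/2)^Suc n *\<^sub>R w = (1/2)^n *\<^sub>R ((1/2) *\<^sub>R w)" for w :: 'y by simp
      ultimately show ?thesis by (simp only:)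
    qed
    ultimately show ?case using Suc by (simp add: scaleR_diff_right)
  qed
  obtain B where B: "\<And>c. c \<in> C \<Longrightarrow> norm c \<le> B"
    using C(3) by (auto simp: bounded_iff)
  have "norm (\<sigma> (Suc n) - \<sigma> n) \<le> B * (1/2)^n" for n
  proof -
    have "norm (\<zeta> (r n)) \<le> B" using \<zeta> r B by blast
    then have "(1/2)^Suc n * norm (\<zeta> (r n)) \<le> (1/2)^n * B"
      by (intro mult_mono) auto
    then show ?thesis by (simp add: \<sigma>_def mult.commute)
  qed
  then obtain s where s: "\<sigma> \<longlonglongrightarrow> s" by (rule geometric_increments_convergent)
  have half0: "(\<lambda>n. (1/2::real)^n) \<longlonglongrightarrow> 0" by (intro LIMSEQ_power_zero) simp
  have "\<zeta> (r 0) \<in> C" using \<zeta> r by blast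
  have "s \<in> C"
  proof (rule closed_sequentially[OF C(1)])
    show "\<sigma> n + (1/2)^n *\<^sub>R \<zeta> (r 0) \<in> C" for n by (rule in_C) fact
    show "(\<lambda>n. \<sigma> n + (1/2)^n *\<^sub>R \<zeta> (r 0)) \<longlonglongrightarrow> s"
      using tendsto_add[OF s tendsto_scaleR[OF half0 tendsto_const[of "\<zeta> (r 0)"]]] by simp
  qed
  moreover have "f s = u + v"
  proof (rule LIMSEQ_unique)
    show "(\<lambda>n. f (\<sigma> n)) \<longlonglongrightarrow> f s" by (rule f.tendsto[OF s])
    have "Bseq (\<lambda>n. u + (1/2) *\<^sub>R r n)"
    proof (rule BseqI')
      fix n
      show "norm (u + (1/2) *\<^sub>R r n) \<le> norm u + e"
        using r[of n] norm_triangle_ineq[of u "(1/2) *\<^sub>R r n"] \<open>0 < e\<close> by simp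
    qed
    then have "(\<lambda>n. (1/2)^n *\<^sub>R (u + (1/2) *\<^sub>R r n)) \<longlonglongrightarrow> 0"
      using half0 by (simp add: Bfun_def tendsto_Zfun_iff bounded_bilinear.Zfun_prod_Bfun[OF bounded_bilinear_scaleR])
    then show "(\<lambda>n. f (\<sigma> n)) \<longlonglongrightarrow> u + v"
      unfolding f\<sigma> using tendsto_diff[OF tendsto_const[of "u + v"]] by fastforce
  qed
  ultimately show ?thesis by (metis imageI)
qed

text \<open>Absorption makes the scaled closures \<open>G k\<close> cover \<open>V\<close>, so by
  Baire one of them has interior around some \<open>v0\<close>. A convex combination with a multiple
  of \<open>- v0\<close> moves that ball to the origin, and
  \<open>ball_in_image_if_in_closure\<close> removes the closure.\<close>

lemma ball_in_image_if_absorbing: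
  fixes f :: "'z::banach \<Rightarrow> 'y::banach"
  assumes f: "bounded_linear f"
    and C: "\<And>n. closed (C n)" "\<And>n. convex (C n)" "\<And>n. bounded (C n)" "incseq C"
    and V: "subspace V" "closed V"
    and absorb: "\<And>v. v \<in> V \<Longrightarrow> \<exists>\<delta>>0. \<forall>t\<in>{0..\<delta>}. u + t *\<^sub>R v \<in> (\<Union>n. f ` C n)"
  obtains n e where "0 < e" "\<And>v. v \<in> V \<Longrightarrow> norm v < e \<Longrightarrow> u + v \<in> f ` C n"
proof -
  interpret f: bounded_linear f by fact
  define D where "D n = {v\<in>V. u + v \<in> f ` C n}" for n
  have D_mono: "D m \<subseteq> D n" if "m \<le> n" for m n
    using incseqD[OF C(4) that] by (auto simp: D_def)
  have conv: "convex (D n)" for n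
  proof (rule convexI)
    fix x y and a b :: real assume x: "x \<in> D n" and y: "y \<in> D n" and ab: "0 \<le> a" "0 \<le> b" "a + b = 1"
    obtain z z' where z: "z \<in> C n" "u + x = f z" "z' \<in> C n" "u + y = f z'"
      using x y by (auto simp: D_def)
    have "u + (a *\<^sub>R x + b *\<^sub>R y) = (a + b) *\<^sub>R u + (a *\<^sub>R x + b *\<^sub>R y)" using ab by simp
    also have "\<dots> = a *\<^sub>R (u + x) + b *\<^sub>R (u + y)" by (simp add: scaleR_add_left scaleR_add_right)
    also have "\<dots> = f (a *\<^sub>R z + b *\<^sub>R z')" by (simp add: z f.add f.scaleR)
    finally show "a *\<^sub>R x + b *\<^sub>R y \<in> D n"
      using x y V(1) convexD[OF C(2) z(1,3) ab] by (auto simp: D_def subspace_add subspace_scale)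
  qed
  define G where "G k = {v\<in>V. (1 / Suc k) *\<^sub>R v \<in> closure (D k)}" for k
  have "\<exists>k. top_of_set V interior_of G k \<noteq> {}"
  proof (rule ccontr)
    assume "\<nexists>k. top_of_set V interior_of G k \<noteq> {}"
    then have empty: "top_of_set V interior_of G k = {}" for k by auto
    have closed: "closedin (top_of_set V) (G k)" for k
    proof -
      have "closed ((\<lambda>v. (1 / Suc k) *\<^sub>R v) -` closure (D k))"
        by (intro closed_vimage closed_closure continuous_intros)
      moreover have "G k = V \<inter> (\<lambda>v. (1 / Suc k) *\<^sub>R v) -` closure (D k)"
        by (auto simp: G_def)
      ultimately show ?thesis by (metis closedin_closed_Int)
    qed
    have "top_of_set V interior_of \<Union>(range G) = {}"
    proof (rule Baire_category_alt)
      have "completely_metrizable_space (top_of_set V)"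
        using V(2) by (intro completely_metrizable_space_closedin[OF completely_metrizable_space_euclidean]) simp
      then show "completely_metrizable_space (top_of_set V) \<or>
          locally_compact_space (top_of_set V) \<and> regular_space (top_of_set V)" by blast
    qed (use closed empty in auto)
    moreover have "\<Union>(range G) = V"
    proof
      show "V \<subseteq> \<Union>(range G)"
      proof
        fix v assume v: "v \<in> V"
        obtain \<delta> where \<delta>: "0 < \<delta>" "\<And>t. 0 \<le> t \<Longrightarrow> t \<le> \<delta> \<Longrightarrow> u + t *\<^sub>R v \<in> (\<Union>n. f ` C n)"
          using absorb[OF v] by auto
        obtain m where m: "1 / real (Suc m) < \<delta>" using nat_approx_posE[OF \<delta>(1)] by auto
        define t where "t = 1 / real (Suc m)"
        obtain j where "u + t *\<^sub>R v \<in> f ` C j" using \<delta>(2)[of t] m by (auto simp: t_def)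
        then have tv: "t *\<^sub>R v \<in> D j" using v V(1) by (simp add: D_def subspace_scale)
        have "0 \<in> \<Union>(range D)"
          using \<delta>(2)[of 0] \<delta>(1) V(1) by (auto simp: D_def subspace_0)
        then obtain i where i: "0 \<in> D i" by auto
        define k where "k = max (max i j) m"
        have "D j \<subseteq> D k" "D i \<subseteq> D k" by (auto simp: k_def intro!: D_mono)
        then have *: "t *\<^sub>R v \<in> D k" "0 \<in> D k" using tv i by auto
        \<comment> \<open>Shrinks the factor \<open>t\<close> to \<open>1 / Suc k\<close>; the
          shorter vector stays in \<open>D k\<close> since \<open>0 \<in> D k\<close>.\<close>
        define a where "a = real (Suc m) / real (Suc k)"
        have a: "0 \<le> a" "a \<le> 1" by (auto simp: a_def k_def)
        have "a *\<^sub>R (t *\<^sub>R v) + (1 - a) *\<^sub>R 0 \<in> D k"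
          using a * by (intro convexD[OF conv]) auto
        moreover have "a *\<^sub>R (t *\<^sub>R v) = (1 / Suc k) *\<^sub>R v"
          by (simp add: a_def t_def)
        ultimately have "(1 / Suc k) *\<^sub>R v \<in> D k"
          by (simp only: scaleR_zero_right add_0_right)
        then have "v \<in> G k" using v closure_subset[of "D k"] by (auto simp: G_def)
        then show "v \<in> \<Union>(range G)" by blast
      qed
    qed (auto simp: G_def)
    ultimately show False
      using subspace_0[OF V(1)] interior_of_topspace[of "top_of_set V"] by auto
  qed
  then obtain k v0 where v0: "v0 \<in> top_of_set V interior_of G k" by blast
  then obtain W where W: "openin (top_of_set V) W" "v0 \<in> W" "W \<subseteq> G k"
    by (auto simp: interior_of_def)
  then obtain e where e: "0 < e" "ball v0 e \<inter> V \<subseteq> W"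
    by (meson openin_contains_ball)
  have v0V: "v0 \<in> V" using W by (auto simp: G_def)
  define c where "c = 1 / real (Suc k)"
  have c: "0 < c" by (simp add: c_def)
  have "- v0 \<in> V" using v0V V(1) by (simp add: subspace_neg)
  then obtain t where t: "0 < t" "u + t *\<^sub>R (- v0) \<in> (\<Union>n. f ` C n)"
    using absorb[of "- v0"] by (metis atLeastAtMost_iff less_eq_real_def)
  then obtain m where "u + t *\<^sub>R (- v0) \<in> f ` C m" by blast
  then have tm: "t *\<^sub>R (- v0) \<in> D m" using \<open>- v0 \<in> V\<close> V(1) by (simp only: D_def mem_Collect_eq subspace_scale simp_thms)
  define n where "n = max k m"
  have tn: "t *\<^sub>R (- v0) \<in> closure (D n)"
    using tm D_mono[of m n] closure_subset[of "D n"] by (auto simp: n_def)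
  \<comment> \<open>The combination that cancels \<open>v0\<close> scales the ball by
    \<open>c * t / (c + t)\<close>.\<close>
  define d where "d = e * (c * t / (c + t))"
  have d: "0 < d" using e c t by (simp add: d_def)
  have ball: "v \<in> closure (D n)" if v: "v \<in> V" "norm v < d" for v
  proof -
    define b where "b = ((c + t) / (c * t)) *\<^sub>R v"
    have "norm b < e" using v(2) c t(1) by (simp add: b_def d_def field_simps)
    moreover have "v0 + b \<in> V"
      unfolding b_def using v0V v(1) V(1) by (intro subspace_add subspace_scale)
    ultimately have "v0 + b \<in> ball v0 e \<inter> V" by (simp add: dist_norm)
    then have "v0 + b \<in> G k" using W(3) e(2) by blast
    then have "c *\<^sub>R (v0 + b) \<in> closure (D k)" by (simp add: G_def c_def)
    then have "c *\<^sub>R (v0 + b) \<in> closure (D n)"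
      using closure_mono[OF D_mono[of k n]] by (auto simp: n_def)
    then have "(t / (c + t)) *\<^sub>R (c *\<^sub>R (v0 + b)) + (c / (c + t)) *\<^sub>R (t *\<^sub>R (- v0)) \<in> closure (D n)"
      using c t(1) by (intro convexD[OF convex_closure[OF conv] _ tn]) (auto simp flip: add_divide_distrib)
    moreover have "(t / (c + t)) *\<^sub>R (c *\<^sub>R (v0 + b)) + (c / (c + t)) *\<^sub>R (t *\<^sub>R (- v0)) = v"
      using c t(1) by (simp add: b_def scaleR_add_right mult.commute)
    ultimately show ?thesis by simp
  qed
  show thesis
  proof (rule that[of "d / 2" n])
    show "0 < d / 2" using d by simp
    fix v assume "v \<in> V" "norm v < d / 2"
    then show "u + v \<in> f ` C n"
      using ball unfolding D_def by (intro ball_in_image_if_in_closure[OF f C(1-3) V(1)])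
  qed
qed

section \<open>Strong representative functions and composition\<close>

locale strong_representation =
  fixes T :: "'y::banach \<Rightarrow> ('y \<Rightarrow>\<^sub>L real) set"
    and h :: "'y \<times> ('y \<Rightarrow>\<^sub>L real) \<Rightarrow> ereal"
  assumes maximal: "maximal_monotone T"
    and strong: "strong_representative_function T h"
begin

lemma h_convex:
  assumes "h p \<le> ereal r" "h q \<le> ereal s" "0 \<le> a" "0 \<le> b" "a + b = 1"
  shows "h (a *\<^sub>R p + b *\<^sub>R q) \<le> ereal (a * r + b * s)"
proof -
  have b: "b = 1 - a" using assms(5) by simp
  have "h (a *\<^sub>R p + b *\<^sub>R q) \<le> ereal a * h p + ereal b * h q"
    using strong assms(3,4) unfolding b strong_representative_function_def representative_function_def convex_ereal_fun_def
    by (simp del: split_paired_All)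
  also have "\<dots> \<le> ereal a * ereal r + ereal b * ereal s"
    using assms by (intro add_mono ereal_mult_left_mono) auto
  finally show ?thesis by simp
qed

lemma h_closed: "closed {p. h p \<le> ereal r}"
  using strong by (simp add: strong_representative_function_def representative_function_def lsc_ereal_fun_def)

lemma coupling_le_h: "ereal (coupling p) \<le> h p"
  using strong unfolding strong_representative_function_def representative_function_def by blast

lemma coupling_le_real: "h p \<le> ereal r \<Longrightarrow> coupling p \<le> r"
  using order_trans[OF coupling_le_h, of p "ereal r"] by simp

lemma h_graph: "p \<in> graph T \<Longrightarrow> h p = ereal (coupling p)"
  using strong by (auto simp: strong_representative_function_def representative_function_def)

lemma h_conj_ge:
  assumes bd: "\<And>p r. h p \<le> ereal r \<Longrightarrow> blinfun_apply v (fst p) + blinfun_apply w (snd p) - r \<le> s"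
  shows "blinfun_apply w v \<le> s"
proof -
  have "conjugate h (v, w) \<le> ereal s"
    unfolding conjugate_def fst_conv snd_conv
  proof (rule SUP_least)
    fix p
    show "ereal (blinfun_apply v (fst p) + blinfun_apply w (snd p)) - h p \<le> ereal s"
      using bd[of p] coupling_le_h[of p] by (cases "h p") auto
  qed
  moreover have "ereal (blinfun_apply w v) \<le> conjugate h (v, w)"
    using strong by (simp add: strong_representative_function_def)
  ultimately have "ereal (blinfun_apply w v) \<le> ereal s" by (rule order_trans[rotated])
  then show ?thesis by simp
qed

lemma effdom_iff: "p \<in> effdom h \<longleftrightarrow> (\<exists>r. h p \<le> ereal r)"
  by (cases "h p") (auto simp: effdom_def)

lemma graph_maximal:
  assumes "\<And>q. q \<in> graph T \<Longrightarrow> 0 \<le> coupling (q - p)"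
  shows "p \<in> graph T"
proof -
  define S where "S y = T y \<union> (if y = fst p then {snd p} else {})" for y
  have S: "graph S = insert p (graph T)"
    by (cases p) (auto simp: S_def graph_def split: if_splits)
  have T: "0 \<le> coupling (q - q')" if "q \<in> graph T" "q' \<in> graph T" for q q'
    using maximal that by (force simp: maximal_monotone_def monotone_op_def coupling_def)
  have "0 \<le> coupling (q - q')" if "q \<in> graph S" "q' \<in> graph S" for q q'
    using that unfolding S
    by (metis T assms coupling_minus_commute coupling_zero diff_self insert_iff order_refl)
  then have "monotone_op S"
    unfolding monotone_op_def coupling_def by force
  then have "graph S = graph T"
    using maximal S unfolding maximal_monotone_def by blast
  then show ?thesis using S by auto
qed

lemma graph_nonempty: "graph T \<noteq> {}"
  using graph_maximal by blast

text \<open>Says that \<open>h\<close> majorizes the Fitzpatrick function of \<open>T\<close>: along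
  the segment from \<open>p\<close>, where \<open>h\<close> touches the coupling, convexity bounds
  the coupling from above.\<close>

lemma graph_below_h:
  assumes p: "p \<in> graph T" and q: "h q \<le> ereal r"
  shows "0 \<le> r - coupling q + coupling (q - p)"
proof (rule nonneg_from_small_perturbation)
  fix t :: real assume t: "0 < t" "t < 1"
  have "h (t *\<^sub>R q + (1 - t) *\<^sub>R p) \<le> ereal (t * r + (1 - t) * coupling p)"
    using t by (intro h_convex q) (auto simp: h_graph[OF p])
  then have "coupling (t *\<^sub>R q + (1 - t) *\<^sub>R p) \<le> t * r + (1 - t) * coupling p"
    by (rule coupling_le_real)
  moreover have "coupling (t *\<^sub>R q + (1 - t) *\<^sub>R p)
      = t * coupling q + (1 - t) * coupling p - t * (1 - t) * coupling (q - p)"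
    by (rule coupling_convex_comb) simp
  ultimately have "0 \<le> t * (r - coupling q + (1 - t) * coupling (q - p))"
    by (simp add: algebra_simps)
  then have "0 \<le> r - coupling q + (1 - t) * coupling (q - p)"
    using t by (simp only: zero_le_mult_iff) auto
  then show "0 \<le> r - coupling q + coupling (q - p) + t * - coupling (q - p) + t\<^sup>2 * 0"
    by (simp add: algebra_simps)
qed

end

section \<open>Composition with the linear map at a shifted point\<close>

lemma blinfun_eq_if_bounded_diff:
  fixes f g :: "'v::real_normed_vector \<Rightarrow>\<^sub>L real"
  assumes "\<And>x. f x - g x \<le> k"
  shows "f = g"
proof (rule blinfun_eqI, rule ccontr)
  fix x assume ne: "f x \<noteq> g x"
  define t where "t = (k + 1) / (f x - g x)"
  have "f (t *\<^sub>R x) - g (t *\<^sub>R x) = t * (f x - g x)"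
    by (simp add: blinfun.scaleR_right algebra_simps)
  also have "\<dots> = k + 1" using ne by (simp add: t_def)
  finally show False using assms[of "t *\<^sub>R x"] by simp
qed

lemma blinfun_compose_add_left: "(f + g) o\<^sub>L k = (f o\<^sub>L k) + (g o\<^sub>L k)"
  and blinfun_compose_scaleR_left: "(a *\<^sub>R f) o\<^sub>L k = a *\<^sub>R (f o\<^sub>L k)"
  by (auto intro!: blinfun_eqI simp: blinfun.bilinear_simps)

locale qualified_composition = strong_representation T h
  for T :: "'y::banach \<Rightarrow> ('y \<Rightarrow>\<^sub>L real) set" and h +
  fixes A :: "'x::banach \<Rightarrow>\<^sub>L 'y" and u :: 'y
  assumes u_ic: "u \<in> ic (setdiff (fst ` effdom h) (range (blinfun_apply A)))"
begin

definition D :: "'y set" where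
  "D = setdiff (fst ` effdom h) (range (blinfun_apply A))"

definition V :: "'y set" where
  "V = affine hull (setdiff D D)"

lemma D_iff: "w \<in> D \<longleftrightarrow> (\<exists>x y ys r. w = y - A x \<and> h (y, ys) \<le> ereal r)"
  unfolding D_def setdiff_def by (force simp: effdom_iff)

lemma u_icr: "u \<in> icr D" and closed_affine_D: "closed (affine hull D)"
  using u_ic unfolding D_def ic_def by (auto split: if_splits)

lemma D_nonempty: "D \<noteq> {}"
proof -
  obtain p where "p \<in> graph T" using graph_nonempty by blast
  then have "h (fst p, snd p) \<le> ereal (coupling p)" by (simp add: h_graph)
  then have "fst p - A 0 \<in> D" unfolding D_iff by blast
  then show ?thesis by blast
qed

lemma subspace_V: "subspace V"
  unfolding V_def by (rule subspace_affine_hull_setdiff[OF D_nonempty])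

lemma closed_V: "closed V"
  unfolding V_def by (rule closed_affine_hull_setdiff[OF D_nonempty closed_affine_D])

lemma absorbing: "v \<in> V \<Longrightarrow> \<exists>\<delta>>0. \<forall>t\<in>{0..\<delta>}. u + t *\<^sub>R v \<in> D"
  using u_icr unfolding icr_def V_def by blast

lemma u_in_D: "u \<in> D"
  using absorbing[OF subspace_0[OF subspace_V]] by force

lemma D_minus_u_in_V: "w \<in> D \<Longrightarrow> w - u \<in> V"
  unfolding V_def using u_in_D by (intro hull_inc) (auto simp: setdiff_def)

text \<open>The open mapping argument for \<open>y - A x\<close> on bounded sublevel sets of
  \<open>h\<close>, closed by lower semicontinuity. The common bound also covers \<open>ys\<close>,
  as the terms with \<open>ys\<close> in \<open>exact_conjugate\<close> require.\<close>

lemma bounded_representation: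
  obtains e K where "0 < e"
    "\<And>w. w \<in> V \<Longrightarrow> norm w < e \<Longrightarrow>
      \<exists>x y ys. u + w = y - A x \<and> norm x \<le> K \<and> norm ys \<le> K \<and> h (y, ys) \<le> ereal K"
proof -
  define C :: "nat \<Rightarrow> ('x \<times> 'y \<times> ('y \<Rightarrow>\<^sub>L real)) set" where
    "C n = {z. norm (fst z) \<le> n} \<inter> {z. norm (snd z) \<le> n} \<inter> snd -` {p. h p \<le> ereal n}" for n
  define f where "f z = fst (snd z) - A (fst z)" for z :: "'x \<times> 'y \<times> ('y \<Rightarrow>\<^sub>L real)"
  have f: "bounded_linear f"
    unfolding f_def by (intro bounded_linear_sub bounded_linear_compose[OF bounded_linear_fst bounded_linear_snd]
        bounded_linear_compose[OF blinfun.bounded_linear_right bounded_linear_fst])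
  have closed: "closed (C n)" for n
    unfolding C_def
    by (intro closed_Int closed_Collect_le continuous_intros closed_vimage h_closed)
  have convex: "convex (C n)" for n
  proof (rule convexI)
    fix z z' and a b :: real
    assume z: "z \<in> C n" "z' \<in> C n" and ab: "0 \<le> a" "0 \<le> b" "a + b = 1"
    have nrm: "norm (a *\<^sub>R x + b *\<^sub>R y) \<le> n" if "norm x \<le> n" "norm y \<le> n" for x y :: "'v::real_normed_vector"
      using convexD[OF convex_cball[of 0 "real n"] _ _ ab, of x y] that by simp
    have "h (a *\<^sub>R snd z + b *\<^sub>R snd z') \<le> ereal (a * n + b * n)"
      using z by (intro h_convex ab) (auto simp: C_def)
    moreover have "a * n + b * n = n" using ab(3) by (metis distrib_right mult_1)
    ultimately show "a *\<^sub>R z + b *\<^sub>R z' \<in> C n"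
      using z by (simp add: C_def nrm)
  qed
  have bounded: "bounded (C n)" for n
  proof (rule boundedI)
    fix z assume "z \<in> C n"
    then have z: "norm (fst z) \<le> n" "norm (snd z) \<le> n" by (auto simp: C_def)
    have "norm z \<le> norm (fst z) + norm (snd z)"
      unfolding norm_prod_def[of z] by (rule sqrt_sum_squares_le_sum) auto
    then show "norm z \<le> n + n" using z by simp
  qed
  have inc: "incseq C"
    unfolding incseq_def C_def by (auto intro: order_trans)
  have D_sub: "D \<subseteq> (\<Union>n. f ` C n)"
  proof
    fix w assume "w \<in> D"
    then obtain x y ys r where w: "w = y - A x" "h (y, ys) \<le> ereal r" unfolding D_iff by blast
    obtain n :: nat where n: "norm x + norm (y, ys) + \<bar>r\<bar> \<le> n" using real_arch_simple by blast
    have "norm x \<le> n" "norm (y, ys) \<le> n" "r \<le> n"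
      using n norm_ge_zero[of x] norm_ge_zero[of "(y, ys)"] by linarith+
    then have "(x, y, ys) \<in> C n"
      using order_trans[OF w(2), of "ereal n"] by (simp add: C_def)
    moreover have "w = f (x, y, ys)" by (simp add: f_def w)
    ultimately show "w \<in> (\<Union>n. f ` C n)" by blast
  qed
  have absorb: "\<exists>\<delta>>0. \<forall>t\<in>{0..\<delta>}. u + t *\<^sub>R v \<in> (\<Union>n. f ` C n)" if "v \<in> V" for v
    using absorbing[OF that] D_sub by blast
  obtain n e where e: "0 < e" "\<And>w. w \<in> V \<Longrightarrow> norm w < e \<Longrightarrow> u + w \<in> f ` C n"
    using ball_in_image_if_absorbing[OF f closed convex bounded inc subspace_V closed_V absorb] by blast
  show thesis
  proof (rule that[OF e(1)])
    fix w assume "w \<in> V" "norm w < e"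
    then obtain z where z: "u + w = f z" "z \<in> C n" using e(2) by blast
    have "norm (snd (snd z)) \<le> n"
      using z(2) dist_snd_le[of "snd z" 0] by (auto simp: C_def)
    with z show "\<exists>x y ys. u + w = y - A x \<and> norm x \<le> n \<and> norm ys \<le> n \<and> h (y, ys) \<le> ereal n"
      by (intro exI[of _ "fst z"] exI[of _ "fst (snd z)"] exI[of _ "snd (snd z)"]) (auto simp: f_def C_def)
  qed
qed

text \<open>Exactness of the conjugate of the composition: the marginal function of the perturbed
  problem is bounded above near the origin of \<open>V\<close>, hence bounded below by a multiple of the
  norm, so the sandwich theorem supplies a subgradient.\<close>

lemma exact_conjugate:
  fixes v :: "'x \<Rightarrow>\<^sub>L real" and w :: "('x \<Rightarrow>\<^sub>L real) \<Rightarrow>\<^sub>L real"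
  assumes bd: "\<And>x ys r. h (A x + u, ys) \<le> ereal r \<Longrightarrow>
      blinfun_apply v x + blinfun_apply w (ys o\<^sub>L A) - (r - blinfun_apply ys u) \<le> s"
  obtains vs where "vs o\<^sub>L A = v"
    "\<And>y ys r. h (y, ys) \<le> ereal r \<Longrightarrow>
      blinfun_apply vs (y - u) + blinfun_apply w (ys o\<^sub>L A) + blinfun_apply ys u - r \<le> s"
proof -
  \<comment> \<open>The first component measures the violation of \<open>y = A x + u\<close>, the
    second is the negated objective; on the fibre over 0 the assumption \<open>bd\<close>
    applies.\<close>
  define C where "C = {(y - u - A x, r - blinfun_apply ys u - blinfun_apply w (ys o\<^sub>L A) - blinfun_apply v x) | x y ys r.
    h (y, ys) \<le> ereal r}"
  have convex_C: "convex C"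
  proof (rule convexI)
    fix c c' and a b :: real assume c: "c \<in> C" "c' \<in> C" and ab: "0 \<le> a" "0 \<le> b" "a + b = 1"
    obtain x y ys r where 1: "c = (y - u - A x, r - blinfun_apply ys u - blinfun_apply w (ys o\<^sub>L A) - blinfun_apply v x)"
      "h (y, ys) \<le> ereal r" using c(1) by (auto simp: C_def)
    obtain x' y' ys' r' where 2: "c' = (y' - u - A x', r' - blinfun_apply ys' u - blinfun_apply w (ys' o\<^sub>L A) - blinfun_apply v x')"
      "h (y', ys') \<le> ereal r'" using c(2) by (auto simp: C_def)
    have "h (a *\<^sub>R y + b *\<^sub>R y', a *\<^sub>R ys + b *\<^sub>R ys') \<le> ereal (a * r + b * r')"
      using h_convex[OF 1(2) 2(2) ab] by simp
    moreover have "a *\<^sub>R u + b *\<^sub>R u = u" using ab(3) by (metis scaleR_add_left scaleR_one)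
    then have "a *\<^sub>R c + b *\<^sub>R c' = ((a *\<^sub>R y + b *\<^sub>R y') - u - A (a *\<^sub>R x + b *\<^sub>R x'),
        (a * r + b * r') - blinfun_apply (a *\<^sub>R ys + b *\<^sub>R ys') u - blinfun_apply w ((a *\<^sub>R ys + b *\<^sub>R ys') o\<^sub>L A)
          - blinfun_apply v (a *\<^sub>R x + b *\<^sub>R x'))"
      unfolding 1 2
      by (simp add: blinfun.bilinear_simps blinfun_compose_add_left blinfun_compose_scaleR_left algebra_simps)
    ultimately show "a *\<^sub>R c + b *\<^sub>R c' \<in> C"
      unfolding C_def by blast
  qed
  have C_zero: "- s \<le> \<rho>" if "(0, \<rho>) \<in> C" for \<rho>
  proof -
    obtain x y ys r where *: "y - u - A x = 0" "\<rho> = r - blinfun_apply ys u - blinfun_apply w (ys o\<^sub>L A) - blinfun_apply v x"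
      "h (y, ys) \<le> ereal r" using \<open>(0, \<rho>) \<in> C\<close> by (auto simp: C_def)
    have "y = A x + u" using *(1) by (simp add: algebra_simps)
    then show ?thesis using bd[of x ys r] * by simp
  qed
  have C_V: "c \<in> V" if "(c, \<rho>) \<in> C" for c \<rho>
  proof -
    obtain x y ys r where "c = (y - A x) - u" "h (y, ys) \<le> ereal r"
      using \<open>(c, \<rho>) \<in> C\<close> by (auto simp: C_def algebra_simps)
    then show ?thesis using D_minus_u_in_V D_iff by blast
  qed
  obtain e K where e: "0 < e" and K: "\<And>w. w \<in> V \<Longrightarrow> norm w < e \<Longrightarrow>
      \<exists>x y ys. u + w = y - A x \<and> norm x \<le> K \<and> norm ys \<le> K \<and> h (y, ys) \<le> ereal K"
    using bounded_representation by blast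
  define R where "R = K + K * norm u + norm w * (K * norm A) + norm v * K"
  have C_bounded: "\<exists>\<rho>\<le>R. (c, \<rho>) \<in> C" if c: "c \<in> V" "norm c < e" for c
  proof -
    obtain x y ys where *: "u + c = y - A x" "norm x \<le> K" "norm ys \<le> K" "h (y, ys) \<le> ereal K"
      using K[OF c] by blast
    have "- blinfun_apply ys u \<le> norm ys * norm u" using norm_blinfun[of ys u] by simp
    also have "\<dots> \<le> K * norm u" using *(3) by (intro mult_right_mono) auto
    finally have 1: "- blinfun_apply ys u \<le> K * norm u" .
    have "- blinfun_apply w (ys o\<^sub>L A) \<le> norm w * norm (ys o\<^sub>L A)" using norm_blinfun[of w "ys o\<^sub>L A"] by simp
    also have "\<dots> \<le> norm w * (norm ys * norm A)"
      by (intro mult_left_mono norm_blinfun_compose) auto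
    also have "\<dots> \<le> norm w * (K * norm A)"
      using *(3) by (intro mult_left_mono mult_right_mono) auto
    finally have 2: "- blinfun_apply w (ys o\<^sub>L A) \<le> norm w * (K * norm A)" .
    have "- blinfun_apply v x \<le> norm v * norm x" using norm_blinfun[of v x] by simp
    also have "\<dots> \<le> norm v * K" using *(2) by (intro mult_left_mono) auto
    finally have 3: "- blinfun_apply v x \<le> norm v * K" .
    have "c = (u + c) - u" by simp
    also have "\<dots> = y - u - A x" unfolding *(1) by simp
    finally have c_eq: "c = y - u - A x" .
    show ?thesis
    proof (intro exI conjI)
      show "K - blinfun_apply ys u - blinfun_apply w (ys o\<^sub>L A) - blinfun_apply v x \<le> R"
        using 1 2 3 by (simp add: R_def)
      show "(c, K - blinfun_apply ys u - blinfun_apply w (ys o\<^sub>L A) - blinfun_apply v x) \<in> C"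
        unfolding C_def c_eq using *(4) by blast
    qed
  qed
  define d where "d = e / 2"
  have d: "0 < d" "d < e" using e by (auto simp: d_def)
  obtain \<rho>0 where \<rho>0: "\<rho>0 \<le> R" "(0, \<rho>0) \<in> C"
    using C_bounded[of 0] subspace_0[OF subspace_V] e by auto
  have Rs: "0 \<le> R + s" using C_zero[OF \<rho>0(2)] \<rho>0(1) by linarith
  define L where "L = (R + s) / d"
  have L: "0 \<le> L" using Rs d by (simp add: L_def)
  have nonneg: "0 \<le> \<rho> + (s + L * norm c)" if c: "(c, \<rho>) \<in> C" for c \<rho>
  proof (cases "c = 0")
    case True
    then show ?thesis using C_zero[of \<rho>] c by simp
  next
    case False
    define n where "n = norm c"
    have n: "0 < n" using False by (simp add: n_def)
    \<comment> \<open>A point opposite to \<open>c\<close>, within the radius of the upper bound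
      \<open>R\<close>; the segment from \<open>c\<close> to \<open>c'\<close> passes through 0,
      where \<open>C_zero\<close> applies.\<close>
    define c' where "c' = (- d / n) *\<^sub>R c"
    have "c' \<in> V"
      unfolding c'_def by (rule subspace_scale[OF subspace_V C_V[OF c]])
    moreover have "norm c' < e" using n d by (simp add: c'_def n_def)
    ultimately obtain \<rho>' where \<rho>': "\<rho>' \<le> R" "(c', \<rho>') \<in> C" using C_bounded by blast
    have "(d / (d + n)) *\<^sub>R (c, \<rho>) + (n / (d + n)) *\<^sub>R (c', \<rho>') \<in> C"
      using d n by (intro convexD[OF convex_C c \<rho>'(2)]) (auto simp flip: add_divide_distrib)
    moreover have "(d / (d + n)) *\<^sub>R c + (n / (d + n)) *\<^sub>R c' = 0"
      using n by (simp add: c'_def)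
    ultimately have "- s \<le> (d / (d + n)) * \<rho> + (n / (d + n)) * \<rho>'"
      using C_zero by simp
    also have "\<dots> = (d * \<rho> + n * \<rho>') / (d + n)" by (simp add: add_divide_distrib)
    finally have "- s * (d + n) \<le> d * \<rho> + n * \<rho>'"
      using d n by (simp add: pos_le_divide_eq)
    moreover have "n * \<rho>' \<le> n * R" using \<rho>'(1) n by (intro mult_left_mono) auto
    ultimately have "0 \<le> d * (\<rho> + s) + n * (R + s)" by (simp add: algebra_simps)
    also have "\<dots> = d * (\<rho> + (s + L * n))" using d by (simp add: L_def field_simps)
    finally show ?thesis using d by (simp add: zero_le_mult_iff n_def)
  qed
  have cvx: "convex_on UNIV (\<lambda>c::'y. s + L * norm c)"
  proof -
    have "convex_on UNIV (\<lambda>c::'y. s)" by (simp add: convex_on_const)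
    moreover have "convex_on UNIV (\<lambda>c::'y. norm (c - 0))"
      by (rule convex_on_UNIV_norm_affine) (simp add: linear_id[unfolded id_def])
    ultimately show ?thesis using L by (intro convex_on_add convex_on_cmul) simp_all
  qed
  have cont: "continuous_on UNIV (\<lambda>c::'y. s + L * norm c)" by (intro continuous_intros)
  have "C \<noteq> {}" using \<rho>0(2) by blast
  then obtain vs \<sigma> where vs: "\<And>c \<rho>. (c, \<rho>) \<in> C \<Longrightarrow> blinfun_apply vs c - \<sigma> \<le> \<rho>"
    and \<sigma>: "\<And>q. 0 \<le> blinfun_apply vs q - \<sigma> + (s + L * norm q)"
    using convex_sandwich[OF convex_C _ cvx cont nonneg] by blast
  have key: "blinfun_apply vs (y - u - A x) - s \<le> r - blinfun_apply ys u - blinfun_apply w (ys o\<^sub>L A) - blinfun_apply v x"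
    if "h (y, ys) \<le> ereal r" for x y ys r
  proof -
    have "(y - u - A x, r - blinfun_apply ys u - blinfun_apply w (ys o\<^sub>L A) - blinfun_apply v x) \<in> C"
      unfolding C_def using that by blast
    from vs[OF this] show ?thesis using \<sigma>[of 0] by simp
  qed
  show thesis
  proof (rule that)
    obtain p where p: "p \<in> graph T" using graph_nonempty by blast
    then have hp: "h (fst p, snd p) \<le> ereal (coupling p)" by (simp add: h_graph)
    \<comment> \<open>\<open>x\<close> is free in \<open>key\<close> while the graph point is fixed,
      so the difference of the two functionals is bounded above and must vanish.\<close>
    have "blinfun_apply v x - blinfun_apply (vs o\<^sub>L A) x
        \<le> s + coupling p - blinfun_apply (snd p) u - blinfun_apply w (snd p o\<^sub>L A) - blinfun_apply vs (fst p - u)" for x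
      using key[OF hp, of x] by (simp add: blinfun.diff_right)
    from blinfun_eq_if_bounded_diff[OF this] show "vs o\<^sub>L A = v" by simp
  next
    fix y ys r assume "h (y, ys) \<le> ereal r"
    from key[OF this, of 0] show "blinfun_apply vs (y - u) + blinfun_apply w (ys o\<^sub>L A) + blinfun_apply ys u - r \<le> s"
      by simp
  qed
qed

text \<open>Subtracting \<open>ys u\<close> matches the pairing of \<open>x\<close> with
  \<open>ys o\<^sub>L A\<close> to that of \<open>A x + u\<close> with \<open>ys\<close>. Different
  \<open>ys\<close> with the same composite remain separate entries, so no infimum has to be
  attained.\<close>

definition E :: "(('x \<times> ('x \<Rightarrow>\<^sub>L real)) \<times> real) set" where
  "E = {((x, ys o\<^sub>L A), r - blinfun_apply ys u) | x ys r. h (A x + u, ys) \<le> ereal r}"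

text \<open>\<open>exact_conjugate\<close> lifts \<open>v\<close> to some \<open>vs\<close> with
  \<open>vs o\<^sub>L A = v\<close>. Strength of \<open>h\<close> is then used at \<open>vs\<close>
  and the second adjoint of \<open>A\<close> applied to \<open>w\<close>, plus
  \<open>canon u\<close>; the contributions of \<open>u\<close> cancel.\<close>

lemma strong_epigraph_E: "strong_epigraph E"
proof
  show "convex E"
  proof (rule convexI)
    fix c c' and a b :: real assume c: "c \<in> E" "c' \<in> E" and ab: "0 \<le> a" "0 \<le> b" "a + b = 1"
    obtain x ys r where 1: "c = ((x, ys o\<^sub>L A), r - blinfun_apply ys u)" "h (A x + u, ys) \<le> ereal r"
      using c(1) by (auto simp: E_def)
    obtain x' ys' r' where 2: "c' = ((x', ys' o\<^sub>L A), r' - blinfun_apply ys' u)" "h (A x' + u, ys') \<le> ereal r'"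
      using c(2) by (auto simp: E_def)
    have "a *\<^sub>R u + b *\<^sub>R u = u" using ab(3) by (metis scaleR_add_left scaleR_one)
    then have "a *\<^sub>R (A x + u) + b *\<^sub>R (A x' + u) = A (a *\<^sub>R x + b *\<^sub>R x') + u"
      by (simp add: blinfun.bilinear_simps algebra_simps)
    then have "h (A (a *\<^sub>R x + b *\<^sub>R x') + u, a *\<^sub>R ys + b *\<^sub>R ys') \<le> ereal (a * r + b * r')"
      using h_convex[OF 1(2) 2(2) ab] by simp
    moreover have "a *\<^sub>R c + b *\<^sub>R c' = ((a *\<^sub>R x + b *\<^sub>R x', (a *\<^sub>R ys + b *\<^sub>R ys') o\<^sub>L A),
        (a * r + b * r') - blinfun_apply (a *\<^sub>R ys + b *\<^sub>R ys') u)"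
      unfolding 1 2
      by (simp add: blinfun.bilinear_simps blinfun_compose_add_left blinfun_compose_scaleR_left algebra_simps)
    ultimately show "a *\<^sub>R c + b *\<^sub>R c' \<in> E"
      unfolding E_def by blast
  qed
next
  fix p r assume "(p, r) \<in> E"
  then obtain x ys r' where *: "p = (x, ys o\<^sub>L A)" "r = r' - blinfun_apply ys u" "h (A x + u, ys) \<le> ereal r'"
    by (auto simp: E_def)
  show "coupling p \<le> r"
    using coupling_le_real[OF *(3)] by (simp add: * coupling_def blinfun.add_right)
next
  fix v w s assume bd: "\<And>p r. (p, r) \<in> E \<Longrightarrow> blinfun_apply v (fst p) + blinfun_apply w (snd p) - r \<le> s"
  have "blinfun_apply v x + blinfun_apply w (ys o\<^sub>L A) - (r - blinfun_apply ys u) \<le> s"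
    if "h (A x + u, ys) \<le> ereal r" for x ys r
    using bd[of "(x, ys o\<^sub>L A)" "r - blinfun_apply ys u"] that by (auto simp: E_def)
  then obtain vs where vs: "vs o\<^sub>L A = v"
    and le: "\<And>y ys r. h (y, ys) \<le> ereal r \<Longrightarrow>
      blinfun_apply vs (y - u) + blinfun_apply w (ys o\<^sub>L A) + blinfun_apply ys u - r \<le> s"
    using exact_conjugate by blast
  have bl: "bounded_linear (\<lambda>ys. blinfun_apply w (ys o\<^sub>L A))"
    by (intro bounded_linear_compose[OF blinfun.bounded_linear_right] bounded_linear_intros)
  have W: "blinfun_apply (Blinfun (\<lambda>ys. blinfun_apply w (ys o\<^sub>L A)) + canon u) ys
      = blinfun_apply w (ys o\<^sub>L A) + blinfun_apply ys u" for ys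
    by (simp add: blinfun.add_left bounded_linear_Blinfun_apply[OF bl])
  have "blinfun_apply (Blinfun (\<lambda>ys. blinfun_apply w (ys o\<^sub>L A)) + canon u) vs \<le> s + blinfun_apply vs u"
  proof (rule h_conj_ge)
    fix p r assume "h p \<le> ereal r"
    then show "blinfun_apply vs (fst p) + blinfun_apply (Blinfun (\<lambda>ys. blinfun_apply w (ys o\<^sub>L A)) + canon u) (snd p) - r
        \<le> s + blinfun_apply vs u"
      unfolding W using le[of "fst p" "snd p" r] by (simp add: blinfun.diff_right)
  qed
  then show "blinfun_apply w v \<le> s"
    unfolding W vs by simp
qed

text \<open>One inclusion is \<open>graph_below_h\<close>. For the other, exactness with
  \<open>w = canon x\<close> produces \<open>vs\<close>, and maximality of \<open>T\<close> puts
  \<open>(A x + u, vs)\<close> into its graph.\<close>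

lemma graph_eq_rep_set: "graph (\<lambda>x. (\<lambda>ys. ys o\<^sub>L A) ` T (A x + u)) = rep_set E"
proof
  show "graph (\<lambda>x. (\<lambda>ys. ys o\<^sub>L A) ` T (A x + u)) \<subseteq> rep_set E"
  proof
    fix q assume "q \<in> graph (\<lambda>x. (\<lambda>ys. ys o\<^sub>L A) ` T (A x + u))"
    then obtain x ys where q: "q = (x, ys o\<^sub>L A)" "(A x + u, ys) \<in> graph T"
      by (auto simp: graph_def)
    show "q \<in> rep_set E"
      unfolding rep_set_def E_def
    proof clarify
      fix x' ys' r assume "h (A x' + u, ys') \<le> ereal r"
      from graph_below_h[OF q(2) this]
      show "blinfun_apply (snd q) (fst (x', ys' o\<^sub>L A)) + blinfun_apply (snd (x', ys' o\<^sub>L A)) (fst q)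
          - (r - blinfun_apply ys' u) \<le> coupling q"
        by (simp add: q coupling_def blinfun.bilinear_simps)
    qed
  qed
next
  show "rep_set E \<subseteq> graph (\<lambda>x. (\<lambda>ys. ys o\<^sub>L A) ` T (A x + u))"
  proof
    fix q assume q: "q \<in> rep_set E"
    obtain x v where xv: "q = (x, v)" by (cases q)
    have "blinfun_apply v x' + blinfun_apply (canon x) (ys o\<^sub>L A) - (r - blinfun_apply ys u) \<le> blinfun_apply v x"
      if "h (A x' + u, ys) \<le> ereal r" for x' ys r
    proof -
      have "((x', ys o\<^sub>L A), r - blinfun_apply ys u) \<in> E" using that by (auto simp: E_def)
      with q show ?thesis by (force simp: rep_set_def xv coupling_def)
    qed
    then obtain vs where vs: "vs o\<^sub>L A = v"
      and le: "\<And>y ys r. h (y, ys) \<le> ereal r \<Longrightarrow>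
        blinfun_apply vs (y - u) + blinfun_apply (canon x) (ys o\<^sub>L A) + blinfun_apply ys u - r \<le> blinfun_apply v x"
      using exact_conjugate by blast
    have "(A x + u, vs) \<in> graph T"
    proof (rule graph_maximal)
      fix p assume p: "p \<in> graph T"
      then have "h (fst p, snd p) \<le> ereal (coupling p)" by (simp add: h_graph)
      from le[OF this] show "0 \<le> coupling (p - (A x + u, vs))"
        unfolding vs[symmetric] by (simp add: coupling_def blinfun.bilinear_simps)
    qed
    then show "q \<in> graph (\<lambda>x. (\<lambda>ys. ys o\<^sub>L A) ` T (A x + u))"
      using vs by (auto simp: graph_def xv)
  qed
qed

lemma gossez_type_D_composition: "gossez_type_D (\<lambda>x. (\<lambda>ys. ys o\<^sub>L A) ` T (A x + u))"
  by (rule strong_epigraph.gossez_type_D_if_graph_eq[OF strong_epigraph_E graph_eq_rep_set])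

lemma u_in_dom_minus_range: "u \<in> setdiff (dom_op T) (range (blinfun_apply A))"
proof -
  obtain q where "q \<in> rep_set E"
    using strong_epigraph.exists_near_rep_set[OF strong_epigraph_E zero_less_one] by blast
  then obtain x ys where "ys \<in> T (A x + u)"
    unfolding graph_eq_rep_set[symmetric] graph_def by auto
  then have "A x + u \<in> dom_op T" by (auto simp: dom_op_def)
  moreover have "u = (A x + u) - A x" by simp
  ultimately show ?thesis unfolding setdiff_def by blast
qed

lemma u_in_ri: "u \<in> ri D"
proof -
  obtain e K where e: "0 < e" and K: "\<And>w. w \<in> V \<Longrightarrow> norm w < e \<Longrightarrow>
      \<exists>x y ys. u + w = y - A x \<and> norm x \<le> K \<and> norm ys \<le> K \<and> h (y, ys) \<le> ereal K"
    using bounded_representation by blast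
  have "ball u e \<inter> affine hull D \<subseteq> D"
  proof
    fix y assume y: "y \<in> ball u e \<inter> affine hull D"
    then have "y - u \<in> V" unfolding V_def by (simp add: affine_hull_setdiff[OF u_in_D])
    moreover have "norm (y - u) < e" using y by (simp add: dist_norm norm_minus_commute)
    ultimately have "u + (y - u) \<in> D" unfolding D_iff using K by blast
    then show "y \<in> D" by simp
  qed
  moreover have "openin (top_of_set (affine hull D)) (ball u e \<inter> affine hull D)"
    by (metis Int_commute open_ball openin_open_Int)
  ultimately have "u \<in> rel_interior D"
    unfolding rel_interior_def using e u_in_D hull_inc[of u D affine] by auto
  then show ?thesis unfolding ri_def using closed_affine_D by simp
qed

end

section \<open>Relative interiors\<close>

lemma openin_affine_segment:
  fixes Q :: "'v::real_normed_vector set"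
  assumes Q: "affine Q" and W: "openin (top_of_set Q) W" and u: "u \<in> W" and y: "y \<in> Q"
  obtains \<delta> where "0 < \<delta>" "\<And>t. 0 \<le> t \<Longrightarrow> t \<le> \<delta> \<Longrightarrow> u + t *\<^sub>R (y - u) \<in> W"
proof -
  obtain e where e: "0 < e" "ball u e \<inter> Q \<subseteq> W"
    using W u by (meson openin_contains_ball)
  have uQ: "u \<in> Q" using W u by (meson openin_imp_subset subsetD)
  define k where "k = norm (y - u) + 1"
  have k: "0 < k" by (simp add: k_def add_nonneg_pos)
  show thesis
  proof (rule that[of "e / (2 * k)"])
    show "0 < e / (2 * k)" using e k by simp
    fix t :: real assume t: "0 \<le> t" "t \<le> e / (2 * k)"
    have "t * norm (y - u) \<le> e / (2 * k) * k"
      using t by (intro mult_mono) (auto simp: k_def)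
    then have "norm (t *\<^sub>R (y - u)) < e" using t e k by simp
    then have "u + t *\<^sub>R (y - u) \<in> ball u e" by (simp add: dist_norm)
    moreover have "(1 - t) *\<^sub>R u + t *\<^sub>R y \<in> Q"
      by (rule mem_affine[OF Q uQ y]) simp
    then have "u + t *\<^sub>R (y - u) \<in> Q" by (simp add: algebra_simps)
    ultimately show "u + t *\<^sub>R (y - u) \<in> W" using e(2) by blast
  qed
qed

lemma affine_hull_openin_affine:
  fixes Q :: "'v::real_normed_vector set"
  assumes Q: "affine Q" and W: "openin (top_of_set Q) W" and "W \<noteq> {}"
  shows "affine hull W = Q"
proof
  show "affine hull W \<subseteq> Q"
    using W Q by (meson hull_minimal openin_imp_subset)
  obtain u where u: "u \<in> W" using assms(3) by blast
  show "Q \<subseteq> affine hull W"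
  proof
    fix y assume "y \<in> Q"
    then obtain \<delta> where \<delta>: "0 < \<delta>" "\<And>t. 0 \<le> t \<Longrightarrow> t \<le> \<delta> \<Longrightarrow> u + t *\<^sub>R (y - u) \<in> W"
      using openin_affine_segment[OF Q W u] by blast
    have "(1 - 1 / \<delta>) *\<^sub>R u + (1 / \<delta>) *\<^sub>R (u + \<delta> *\<^sub>R (y - u)) \<in> affine hull W"
      using \<delta> u by (intro mem_affine affine_affine_hull hull_inc) auto
    then show "y \<in> affine hull W"
      using \<delta>(1) by (simp add: algebra_simps)
  qed
qed

lemma ri_subset_ic:
  fixes D :: "'v::real_normed_vector set"
  shows "ri D \<subseteq> ic D"
proof
  fix u assume "u \<in> ri D"
  then have cl: "closed (affine hull D)" and "u \<in> rel_interior D"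
    by (auto simp: ri_def split: if_splits)
  then obtain W where W: "openin (top_of_set (affine hull D)) W" "u \<in> W" "W \<subseteq> D"
    by (auto simp: rel_interior_def)
  have "u \<in> icr D"
    unfolding icr_def mem_Collect_eq
  proof
    fix x assume "x \<in> affine hull (setdiff D D)"
    moreover have "u \<in> D" using W by blast
    ultimately obtain y where "y \<in> affine hull D" "x = y - u"
      by (auto simp: affine_hull_setdiff)
    then show "\<exists>\<delta>>0. \<forall>t\<in>{0..\<delta>}. u + t *\<^sub>R x \<in> D"
      using openin_affine_segment[OF affine_affine_hull W(1,2)] W(3) by (metis atLeastAtMost_iff subsetD)
  qed
  then show "u \<in> ic D" using cl by (simp add: ic_def)
qed

lemma ic_mono:
  fixes D D' :: "'v::real_normed_vector set"
  assumes D: "D \<noteq> {}" "D \<subseteq> D'" and sub: "closed (affine hull D) \<Longrightarrow> D' \<subseteq> affine hull D"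
  shows "ic D \<subseteq> ic D'"
proof (cases "closed (affine hull D)")
  case True
  have eq: "affine hull D' = affine hull D"
    using sub[OF True] D(2) by (meson hull_minimal affine_affine_hull hull_mono subset_antisym)
  obtain a where a: "a \<in> D" using D(1) by blast
  have "affine hull (setdiff D' D') = affine hull (setdiff D D)"
    using a D(2) by (simp add: affine_hull_setdiff[of a] subsetD eq)
  then have "icr D \<subseteq> icr D'"
    unfolding icr_def using D(2) by (simp, blast)
  then show ?thesis using True by (simp add: ic_def eq)
qed (simp add: ic_def)

text \<open>A nonempty relatively open part of \<open>D'\<close> spans its whole affine hull; lying
  in \<open>D\<close>, it forces both hulls to coincide.\<close>

lemma ri_subset_ri_intermediate:
  fixes D D' :: "'v::real_normed_vector set"
  assumes "ri D' \<subseteq> D" "D \<subseteq> D'"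
  shows "ri D' \<subseteq> ri D"
proof
  fix u assume u: "u \<in> ri D'"
  then have cl: "closed (affine hull D')" and "u \<in> rel_interior D'"
    by (auto simp: ri_def split: if_splits)
  then obtain W where W: "openin (top_of_set (affine hull D')) W" "u \<in> W" "W \<subseteq> D'"
    by (auto simp: rel_interior_def)
  have "W \<subseteq> ri D'" using W cl by (auto simp: ri_def rel_interior_def)
  then have WD: "W \<subseteq> D" using assms(1) by blast
  have "affine hull D' = affine hull W"
    using affine_hull_openin_affine[OF affine_affine_hull W(1)] W(2) by blast
  then have "affine hull D' = affine hull D"
    using WD assms(2) by (metis hull_mono subset_antisym)
  then show "u \<in> ri D"
    using W WD cl by (auto simp: ri_def rel_interior_def)
qed

context strong_representation
begin

lemma dom_op_subset_effdom: "dom_op T \<subseteq> fst ` effdom h"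
proof
  fix y assume "y \<in> dom_op T"
  then obtain ys where "(y, ys) \<in> graph T" by (auto simp: dom_op_def graph_def)
  then have "(y, ys) \<in> effdom h" unfolding effdom_iff using h_graph by force
  then show "y \<in> fst ` effdom h" by force
qed

lemma convex_effdom: "convex (effdom h)"
proof (rule convexI)
  fix p q and a b :: real assume "p \<in> effdom h" "q \<in> effdom h" "0 \<le> a" "0 \<le> b" "a + b = 1"
  then show "a *\<^sub>R p + b *\<^sub>R q \<in> effdom h"
    unfolding effdom_iff by (meson h_convex)
qed

text \<open>If a point of the left-hand side were outside, a separating functional would be constant
  on \<open>dom_op T\<close>; all its multiples could then be added to the values of \<open>T\<close>, making \<open>h\<close>
  infinite at that point.\<close>

lemma effdom_minus_range_subset_affine_hull:
  fixes A :: "'x::real_normed_vector \<Rightarrow>\<^sub>L 'y"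
  assumes cl: "closed (affine hull S)"
    and sub: "setdiff (dom_op T) (range (blinfun_apply A)) \<subseteq> S"
  shows "setdiff (fst ` effdom h) (range (blinfun_apply A)) \<subseteq> affine hull S"
proof
  fix w assume "w \<in> setdiff (fst ` effdom h) (range (blinfun_apply A))"
  then obtain y ys x0 r where w: "w = y - A x0" and h: "h (y, ys) \<le> ereal r"
    unfolding setdiff_def by (force simp: effdom_iff)
  let ?Q = "affine hull S"
  have Q: "b - A x \<in> ?Q" if "(b, bs) \<in> graph T" for b bs x
  proof -
    have "b \<in> dom_op T" using that by (auto simp: dom_op_def graph_def)
    then have "b - A x \<in> setdiff (dom_op T) (range (blinfun_apply A))"
      unfolding setdiff_def by blast
    then show ?thesis using sub by (intro hull_inc) blast
  qed
  obtain a as where a: "(a, as) \<in> graph T" using graph_nonempty by fastforce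
  show "w \<in> ?Q"
  proof (rule ccontr)
    assume "w \<notin> ?Q"
    then obtain d where d: "0 < d" "\<And>q. q \<in> ?Q \<Longrightarrow> d \<le> dist w q"
      using closure_approachable[of w ?Q] closure_closed[OF cl] by (metis dist_commute not_less)
    have E: "convex (?Q \<times> {0::real})" "?Q \<times> {0::real} \<noteq> {}"
      using Q[OF a] by (auto intro: convex_Times affine_imp_convex affine_affine_hull)
    have cvx: "convex_on UNIV (\<lambda>q. norm (q - w) + (- d))"
      by (intro convex_on_add convex_on_UNIV_norm_affine) (auto simp: convex_on_const linear_id[unfolded id_def])
    have cont: "continuous_on UNIV (\<lambda>q. norm (q - w) + (- d))" by (intro continuous_intros)
    have nonneg: "0 \<le> r + (norm (q - w) + (- d))" if "(q, r) \<in> ?Q \<times> {0}" for q r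
      using d(2)[of q] that by (auto simp: dist_norm norm_minus_commute)
    obtain l \<sigma> where l: "\<And>q r. (q, r) \<in> ?Q \<times> {0::real} \<Longrightarrow> blinfun_apply l q - \<sigma> \<le> r"
      and lw: "\<And>q. 0 \<le> blinfun_apply l q - \<sigma> + (norm (q - w) + (- d))"
      using convex_sandwich[OF E cvx cont nonneg] by blast
    \<comment> \<open>A functional bounded above on an affine set is constant on it.\<close>
    have const: "l q = l q'" if q: "q \<in> ?Q" "q' \<in> ?Q" for q q'
    proof (rule ccontr)
      assume ne: "l q \<noteq> l q'"
      define t where "t = (\<sigma> - l q' + 1) / (l q - l q')"
      have "t *\<^sub>R q + (1 - t) *\<^sub>R q' \<in> ?Q"
        by (rule mem_affine[OF affine_affine_hull q]) simp
      then have "l (t *\<^sub>R q + (1 - t) *\<^sub>R q') \<le> \<sigma>" using l[of _ 0] by simp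
      then have "l q' + t * (l q - l q') \<le> \<sigma>"
        by (simp add: blinfun.bilinear_simps algebra_simps)
      then show False using ne by (simp add: t_def)
    qed
    have lA: "l (A x) = 0" for x
      using const[OF Q[OF a, of x] Q[OF a, of 0]] by (simp add: blinfun.bilinear_simps)
    have ldom: "l b = l a" if "(b, bs) \<in> graph T" for b bs
      using const[OF Q[OF that, of 0] Q[OF a, of 0]] by simp
    have "l a \<le> \<sigma>" using l[of "a - A 0" 0] Q[OF a, of 0] by simp
    moreover have "\<sigma> + d \<le> l y" using lw[of w] by (simp add: w blinfun.diff_right lA)
    ultimately have gap: "0 < l y - l a" using d(1) by linarith
    have shifted: "(a, as + t *\<^sub>R l) \<in> graph T" for t
    proof (rule graph_maximal)
      fix q assume q: "q \<in> graph T"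
      have "0 \<le> coupling (q - (a, as))"
        using maximal q a by (force simp: maximal_monotone_def monotone_op_def coupling_def)
      moreover have "l (fst q) = l a" using ldom[of "fst q" "snd q"] q by simp
      ultimately show "0 \<le> coupling (q - (a, as + t *\<^sub>R l))"
        by (simp add: coupling_def blinfun.bilinear_simps)
    qed
    define k where "k = r - coupling (y, ys) + blinfun_apply (ys - as) (y - a)"
    have "t * (l y - l a) \<le> k" for t
      using graph_below_h[OF shifted[of t] h]
      by (simp add: k_def coupling_def blinfun.bilinear_simps algebra_simps)
    from this[of "(k + 1) / (l y - l a)"] show False using gap by simp
  qed
qed

end

theorem theorem4p7:
  fixes T :: "'y::banach \<Rightarrow> ('y \<Rightarrow>\<^sub>L real) set"
    and h :: "'y \<times> ('y \<Rightarrow>\<^sub>L real) \<Rightarrow> ereal"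
    and A :: "'x::banach \<Rightarrow>\<^sub>L 'y"
  assumes X_nonzero: "\<exists>x::'x. x \<noteq> 0"
    and Y_nonzero: "\<exists>y::'y. y \<noteq> 0"
    and T_D: "gossez_type_D T"
    and h_strong: "strong_representative_function T h"
    and qual: "fst ` effdom h \<inter> range (blinfun_apply A) \<noteq> {}"
  defines "S1 \<equiv> setdiff (dom_op T) (range (blinfun_apply A))"
    and "S2 \<equiv> setdiff (convex hull (dom_op T)) (range (blinfun_apply A))"
    and "S3 \<equiv> setdiff (fst ` effdom h) (range (blinfun_apply A))"
  shows "ic S1 = ri S1 \<and> ri S1 = ic S2 \<and> ic S2 = ri S2 \<and> ri S2 = ic S3 \<and> ic S3 = ri S3
       \<and> ((0 \<in> ic S1) = (0 \<in> ri S1) \<and> (0 \<in> ri S1) = (0 \<in> ic S2) \<and> (0 \<in> ic S2) = (0 \<in> ri S2)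
          \<and> (0 \<in> ri S2) = (0 \<in> ic S3) \<and> (0 \<in> ic S3) = (0 \<in> ri S3))
       \<and> (0 \<in> ic S1 \<longrightarrow> gossez_type_D (adj_comp A T))"
proof -
  interpret strong_representation T h
    using T_D h_strong by unfold_locales (auto simp: gossez_type_D_def)
  have comp: "qualified_composition T h A u" if "u \<in> ic S3" for u
    using that by unfold_locales (simp add: S3_def)
  have "convex (fst ` effdom h)"
    by (rule convex_linear_image[OF linear_fst convex_effdom])
  then have "convex hull (dom_op T) \<subseteq> fst ` effdom h"
    by (intro hull_minimal dom_op_subset_effdom)
  then have S23: "S2 \<subseteq> S3" unfolding S2_def S3_def setdiff_def by blast
  have S12: "S1 \<subseteq> S2"
    unfolding S1_def S2_def setdiff_def using hull_subset[of "dom_op T" convex] by blast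
  have "dom_op T \<noteq> {}" using graph_nonempty by (auto simp: dom_op_def graph_def)
  then have S1_ne: "S1 \<noteq> {}" unfolding S1_def setdiff_def by blast
  have ic_S3: "ic S3 \<subseteq> S1" "ic S3 \<subseteq> ri S3"
    using qualified_composition.u_in_dom_minus_range[OF comp]
      qualified_composition.u_in_ri[OF comp] qualified_composition.D_def[OF comp]
    unfolding S1_def S3_def by auto
  \<comment> \<open>The cycle \<open>ic S \<subseteq> ic S3 \<subseteq> ri S3 \<subseteq> ri S
    \<subseteq> ic S\<close> closes for every intermediate \<open>S\<close>.\<close>
  have eq: "ic S = ic S3 \<and> ri S = ic S3" if S: "S1 \<subseteq> S" "S \<subseteq> S3" for S
  proof -
    have "ic S \<subseteq> ic S3"
    proof (rule ic_mono[OF _ S(2)])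
      show "S \<noteq> {}" using S1_ne S(1) by blast
      show "S3 \<subseteq> affine hull S" if "closed (affine hull S)"
        unfolding S3_def using effdom_minus_range_subset_affine_hull[OF that] S(1) unfolding S1_def by blast
    qed
    moreover have "ri S3 \<subseteq> ri S"
      using ri_subset_ic[of S3] ic_S3(1) S by (intro ri_subset_ri_intermediate) auto
    ultimately show ?thesis using ic_S3(2) ri_subset_ic[of S] by blast
  qed
  have "ic S1 = ic S3" "ri S1 = ic S3" "ic S2 = ic S3" "ri S2 = ic S3" "ri S3 = ic S3"
    using eq[of S1] eq[of S2] eq[of S3] S12 S23 by auto
  moreover have "gossez_type_D (adj_comp A T)" if "0 \<in> ic S3"
  proof -
    have "adj_comp A T = (\<lambda>x. (\<lambda>ys. ys o\<^sub>L A) ` T (A x + 0))"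
      by (simp add: fun_eq_iff adj_comp_def)
    then show ?thesis
      using qualified_composition.gossez_type_D_composition[OF comp[OF that]] by simp
  qed
  ultimately show ?thesis by simp
qed

end
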